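(* There are no non-trivial linear relations between the commutators $\{\overline{\mathsf{e}}_f,\overline{\mathsf{e}}_g\}$ for $f,g\in \mathsf{S}$; that is, the linear map $$\Lambda^2\mathsf{S}\longrightarrow \mathbb{Q}[x_1,\ldots,x_8],\qquad f\wedge g\mapsto \{\overline{\mathsf{e}}_f,\overline{\mathsf{e}}_g\}$$ is injective.
   Context: For $n\ge 1$, $\mathsf{S}_{2n}\subset \mathbb{Q}[X,Y]$ is the $\mathbb{Q}$-vector space of homogeneous polynomials $P(X,Y)$ of degree $2n-2$ such that $P(X,Y)+P(Y,X)=0$, $P(\pm X,\pm Y)=P(X,Y)$ (all choices of signs), $P(X,Y)+P(X-Y,X)+P(-Y,X-Y)=0$, and $P(1,0)=0$; $\mathsf{S}=\bigoplus_n \mathsf{S}_{2n}$. Any $f\in \mathsf{S}_{2n}$ can be written $f(x,y)=xy(x-y)f_0(x,y)$ with $f_0\in\mathbb{Q}[x,y]$; put $f_1(x,y)=(x-y)f_0(x,y)$ and $$\mathsf{e}_f=\sum_{\mathbb{Z}/5\mathbb{Z}}\Big(f_1(y_4-y_3,y_2-y_1)+(y_0-y_1)f_0(y_2-y_3,y_4-y_3)\Big)\in\mathbb{Q}[y_0,\ldots,y_4],$$ the sum being over the cyclic permutations generated by $(y_0,y_1,y_2,y_3,y_4)\mapsto(y_1,y_2,y_3,y_4,y_0)$; extend linearly to $f\in\mathsf{S}$. The polynomial $\overline{\mathsf{e}}_f\in\mathbb{Q}[x_1,\ldots,x_4]$ is $\mathsf{e}_f$ with $y_0=0$, $y_i=x_i$.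 Ihara bracket on polynomials. For $f\in\mathbb{Q}[y_0,\ldots,y_r]$ (homogeneous) and $g\in\mathbb{Q}[y_0,\ldots,y_s]$, $$f\,\underline{\circ}\,g\,(y_0,\ldots,y_{r+s})=\sum_{i=0}^s f(y_i,\ldots,y_{i+r})\,g(y_0,\ldots,y_i,y_{i+r+1},\ldots,y_{r+s})+(-1)^{\deg f+r}\sum_{i=1}^s f(y_{i+r},\ldots,y_i)\,g(y_0,\ldots,y_{i-1},y_{i+r},\ldots,y_{r+s}),$$ extended linearly, and $\{f,g\}=f\,\underline{\circ}\,g-g\,\underline{\circ}\,f$. The polynomials $\mathsf{e}_f$ are invariant under simultaneous translation of the $y_i$, so they are determined by $\overline{\mathsf{e}}_f$, and $\{\overline{\mathsf{e}}_f,\overline{\mathsf{e}}_g\}\in\mathbb{Q}[x_1,\ldots,x_8]$ denotes $\{\mathsf{e}_f,\mathsf{e}_g\}\in\mathbb{Q}[y_0,\ldots,y_8]$ with $y_0=0$, $y_i=x_i$. *)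

theory Defs
  imports Complex_Main "HOL-Library.Poly_Mapping" "HOL-Library.FuncSet"
begin

section \<open>Rational vector spaces of finitely supported functions\<close>

definition scl :: "rat \<Rightarrow> ('a \<Rightarrow>\<^sub>0 rat) \<Rightarrow> ('a \<Rightarrow>\<^sub>0 rat)" where
  "scl c p = Poly_Mapping.map (\<lambda>a. c * a) p"

lemma lookup_scl [simp]: "Poly_Mapping.lookup (scl c p) k = c * Poly_Mapping.lookup p k"
  by (simp add: scl_def Poly_Mapping.map.rep_eq when_def)

global_interpretation qvs: vector_space "scl :: rat \<Rightarrow> ('a \<Rightarrow>\<^sub>0 rat) \<Rightarrow> ('a \<Rightarrow>\<^sub>0 rat)"
  by unfold_locales (rule poly_mapping_eqI, simp add: lookup_add algebra_simps)+


section \<open>Polynomials over the rationals\<close>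

text \<open>The variables are indexed by natural numbers; all the rings
  Q[X,Y] (variables 0 and 1), Q[y_0,...,y_r] and Q[x_1,...,x_r] are subsets of this type.\<close>

type_synonym mpol = "(nat \<Rightarrow>\<^sub>0 nat) \<Rightarrow>\<^sub>0 rat"

definition Var :: "nat \<Rightarrow> mpol" where
  "Var i = Poly_Mapping.single (Poly_Mapping.single i 1) 1"

definition polys_in :: "nat set \<Rightarrow> mpol set" where
  "polys_in V = {p. \<forall>m\<in>Poly_Mapping.keys p. Poly_Mapping.keys m \<subseteq> V}"

definition mdeg :: "(nat \<Rightarrow>\<^sub>0 nat) \<Rightarrow> nat" where
  "mdeg m = (\<Sum>i\<in>Poly_Mapping.keys m. Poly_Mapping.lookup m i)"

definition homogeneous :: "nat \<Rightarrow> mpol \<Rightarrow> bool" where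
  "homogeneous d p \<longleftrightarrow> (\<forall>m\<in>Poly_Mapping.keys p. mdeg m = d)"

definition hcomp :: "nat \<Rightarrow> mpol \<Rightarrow> mpol" where
  "hcomp d p = (\<Sum>m\<in>{m \<in> Poly_Mapping.keys p. mdeg m = d}.
                  Poly_Mapping.single m (Poly_Mapping.lookup p m))"

text \<open>Linear extension to arbitrary polynomials of an operation \<open>F d\<close> that is given on
  homogeneous polynomials of degree \<open>d\<close>.\<close>

definition extend_hom :: "(nat \<Rightarrow> mpol \<Rightarrow> mpol) \<Rightarrow> mpol \<Rightarrow> mpol" where
  "extend_hom F p = (\<Sum>d\<in>mdeg ` Poly_Mapping.keys p. F d (hcomp d p))"

text \<open>Substitution: \<open>psubst p [a\<^sub>0,\<dots>,a\<^sub>r]\<close> is \<open>p(a\<^sub>0,\<dots>,a\<^sub>r)\<close>. It is only meaningful for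
  \<open>p \<in> polys_in {0..r}\<close>.\<close>

definition psubst :: "mpol \<Rightarrow> mpol list \<Rightarrow> mpol" where
  "psubst p as = (\<Sum>m\<in>Poly_Mapping.keys p.
     scl (Poly_Mapping.lookup p m)
       (\<Prod>i\<in>Poly_Mapping.keys m. (as ! i) ^ Poly_Mapping.lookup m i))"


section \<open>Even period polynomials and the exceptional elements\<close>

definition period_hom :: "nat \<Rightarrow> mpol set" where
  "period_hom n = {P. P \<in> polys_in {0, 1} \<and> homogeneous (2 * n - 2) P \<and>
     (let X = Var 0; Y = Var 1 in
        psubst P [X, Y] + psubst P [Y, X] = 0 \<and>
        (\<forall>a\<in>{X, - X}. \<forall>b\<in>{Y, - Y}. psubst P [a, b] = psubst P [X, Y]) \<and>
        psubst P [X, Y] + psubst P [X - Y, X] + psubst P [- Y, X - Y] = 0 \<and>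
        psubst P [1, 0] = 0)}"

definition period_space :: "mpol set" where
  "period_space = qvs.span (\<Union>n\<in>{1..}. period_hom n)"

definition f0 :: "mpol \<Rightarrow> mpol" where
  "f0 f = (THE h. h \<in> polys_in {0, 1} \<and> f = Var 0 * Var 1 * (Var 0 - Var 1) * h)"

definition f1 :: "mpol \<Rightarrow> mpol" where
  "f1 f = (Var 0 - Var 1) * f0 f"

definition e_hom :: "mpol \<Rightarrow> mpol" where
  "e_hom f = (\<Sum>k<5. let y = (\<lambda>j. Var ((j + k) mod 5)) in
      psubst (f1 f) [y 4 - y 3, y 2 - y 1]
      + (y 0 - y 1) * psubst (f0 f) [y 2 - y 3, y 4 - y 3])"

definition e_poly :: "mpol \<Rightarrow> mpol" where
  "e_poly = extend_hom (\<lambda>d. e_hom)"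


section \<open>The Ihara bracket\<close>

text \<open>\<open>circ r s f g\<close> takes \<open>f\<close> in Q[y_0,...,y_r] and \<open>g\<close> in Q[y_0,...,y_s]. The formula is linear
  in \<open>g\<close>, whereas its sign depends on the degree \<open>d\<close> of the homogeneous polynomial \<open>f\<close>.\<close>

definition circ_hom :: "nat \<Rightarrow> nat \<Rightarrow> nat \<Rightarrow> mpol \<Rightarrow> mpol \<Rightarrow> mpol" where
  "circ_hom r s d f g =
     (\<Sum>i\<in>{0..s}. psubst f (map Var [i..<i + r + 1])
                  * psubst g (map Var ([0..<i + 1] @ [i + r + 1..<r + s + 1])))
     + (- 1) ^ (d + r) *
     (\<Sum>i\<in>{1..s}. psubst f (map Var (rev [i..<i + r + 1]))
                  * psubst g (map Var ([0..<i] @ [i + r..<r + s + 1])))"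

definition circ :: "nat \<Rightarrow> nat \<Rightarrow> mpol \<Rightarrow> mpol \<Rightarrow> mpol" where
  "circ r s f g = extend_hom (\<lambda>d h. circ_hom r s d h g) f"

definition ihara_bracket :: "nat \<Rightarrow> nat \<Rightarrow> mpol \<Rightarrow> mpol \<Rightarrow> mpol" where
  "ihara_bracket r s f g = circ r s f g - circ s r g f"

definition reduced :: "nat \<Rightarrow> mpol \<Rightarrow> mpol" where
  "reduced r p = psubst p (0 # map Var [1..<r + 1])"

text \<open>The bracket of the reduced polynomials of \<open>e_poly f\<close> and \<open>e_poly g\<close>; by translation invariance of
  \<open>e_poly f\<close> and \<open>e_poly g\<close> it is computed on these unreduced polynomials.\<close>

definition e_bracket :: "mpol \<Rightarrow> mpol \<Rightarrow> mpol" where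
  "e_bracket f g = reduced 8 (ihara_bracket 4 4 (e_poly f) (e_poly g))"


section \<open>The exterior square of a subspace\<close>

text \<open>The exterior square of a subspace \<open>V\<close> is the quotient of the free vector space on
  \<open>V \<times> V\<close> by the relations of bilinearity and alternation. Its elements are cosets.\<close>

definition gen :: "'a \<Rightarrow> 'a \<Rightarrow> ('a \<times> 'a) \<Rightarrow>\<^sub>0 rat" where
  "gen f g = Poly_Mapping.single (f, g) 1"

definition free2 :: "'a set \<Rightarrow> (('a \<times> 'a) \<Rightarrow>\<^sub>0 rat) set" where
  "free2 V = {u. Poly_Mapping.keys u \<subseteq> V \<times> V}"

definition ext2_relators :: "('b \<Rightarrow>\<^sub>0 rat) set \<Rightarrow> ((('b \<Rightarrow>\<^sub>0 rat) \<times> ('b \<Rightarrow>\<^sub>0 rat)) \<Rightarrow>\<^sub>0 rat) set" where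
  "ext2_relators V =
     {gen (f + f') g - gen f g - gen f' g | f f' g. f \<in> V \<and> f' \<in> V \<and> g \<in> V} \<union>
     {gen f (g + g') - gen f g - gen f g' | f g g'. f \<in> V \<and> g \<in> V \<and> g' \<in> V} \<union>
     {gen (scl c f) g - scl c (gen f g) | c f g. f \<in> V \<and> g \<in> V} \<union>
     {gen f (scl c g) - scl c (gen f g) | c f g. f \<in> V \<and> g \<in> V} \<union>
     {gen f f | f. f \<in> V}"

definition ext2_rel ::
  "('b \<Rightarrow>\<^sub>0 rat) set \<Rightarrow> ((('b \<Rightarrow>\<^sub>0 rat) \<times> ('b \<Rightarrow>\<^sub>0 rat)) \<Rightarrow>\<^sub>0 rat) rel" where
  "ext2_rel V = {(u, v). u \<in> free2 V \<and> v \<in> free2 V \<and> u - v \<in> qvs.span (ext2_relators V)}"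

definition ext2 ::
  "('b \<Rightarrow>\<^sub>0 rat) set \<Rightarrow> ((('b \<Rightarrow>\<^sub>0 rat) \<times> ('b \<Rightarrow>\<^sub>0 rat)) \<Rightarrow>\<^sub>0 rat) set set" where
  "ext2 V = free2 V // ext2_rel V"

abbreviation ext2_class ::
  "('b \<Rightarrow>\<^sub>0 rat) set \<Rightarrow> ((('b \<Rightarrow>\<^sub>0 rat) \<times> ('b \<Rightarrow>\<^sub>0 rat)) \<Rightarrow>\<^sub>0 rat)
    \<Rightarrow> ((('b \<Rightarrow>\<^sub>0 rat) \<times> ('b \<Rightarrow>\<^sub>0 rat)) \<Rightarrow>\<^sub>0 rat) set" where
  "ext2_class V u \<equiv> ext2_rel V `` {u}"

definition wedge ::
  "('b \<Rightarrow>\<^sub>0 rat) set \<Rightarrow> ('b \<Rightarrow>\<^sub>0 rat) \<Rightarrow> ('b \<Rightarrow>\<^sub>0 rat)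
    \<Rightarrow> ((('b \<Rightarrow>\<^sub>0 rat) \<times> ('b \<Rightarrow>\<^sub>0 rat)) \<Rightarrow>\<^sub>0 rat) set" where
  "wedge V f g = ext2_class V (gen f g)"

text \<open>Addition and scaling of cosets are those of representatives.\<close>

definition ext2_linear ::
  "('b \<Rightarrow>\<^sub>0 rat) set \<Rightarrow> (((('b \<Rightarrow>\<^sub>0 rat) \<times> ('b \<Rightarrow>\<^sub>0 rat)) \<Rightarrow>\<^sub>0 rat) set \<Rightarrow> ('c \<Rightarrow>\<^sub>0 rat)) \<Rightarrow> bool" where
  "ext2_linear V L \<longleftrightarrow>
     (\<forall>u\<in>free2 V. \<forall>v\<in>free2 V.
        L (ext2_class V (u + v)) = L (ext2_class V u) + L (ext2_class V v)) \<and>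
     (\<forall>c. \<forall>u\<in>free2 V. L (ext2_class V (scl c u)) = scl c (L (ext2_class V u)))"

end

theory Submission
  imports Defs
begin

text \<open>
  The map is injective because the coefficients of a bracket at suitable monomials are the
  \<open>2 \<times> 2\<close> minors of a matrix that determines the period polynomials.

  Write \<open>f = X Y (X - Y) f\<^sub>0\<close> and \<open>f\<^sub>1 = (X - Y) f\<^sub>0\<close>. Since \<open>f\<close> is alternating and even in each variable,
  \<open>f\<^sub>1\<close> is alternating and odd in each variable. Hence \<open>e\<^sub>f\<close>, which is cyclically invariant, vanishes at
  points with a single non-zero coordinate, and \<open>e\<^sub>f(a, b, 0, 0, 0) = f\<^sub>1(a, b)\<close>. Set all variables
  to zero in a bracket except \<open>x\<^sub>1, x\<^sub>2, x\<^sub>4, x\<^sub>5\<close>. Of the nine products in \<open>e\<^sub>f \<circ> e\<^sub>g\<close> this leaves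
  \<open>e\<^sub>f(x\<^sub>4, x\<^sub>5, 0, x\<^sub>2, 0) g\<^sub>1(x\<^sub>1, x\<^sub>2) + f\<^sub>1(x\<^sub>4, x\<^sub>5) e\<^sub>g(x\<^sub>1, x\<^sub>2, 0, x\<^sub>4, 0) - f\<^sub>1(x\<^sub>4, x\<^sub>5) g\<^sub>1(x\<^sub>1, x\<^sub>2)\<close>
  (\<open>psubst_e_circ\<close>).
  Now keep only the monomials in which all four exponents are odd and at least \<open>3\<close>. In
  \<open>e\<^sub>f(a, b, 0, c, 0)\<close> every term other than \<open>f\<^sub>1(a, b)\<close> is of degree at most one in \<open>a\<close> or in \<open>b\<close>, or is
  odd in \<open>c\<close>; the latter kind becomes even in \<open>c\<close> after multiplication by a \<open>g\<^sub>1\<close> that involves \<open>c\<close>.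
  So each of the two mixed products contributes \<open>f\<^sub>1(x\<^sub>4, x\<^sub>5) g\<^sub>1(x\<^sub>1, x\<^sub>2)\<close>, and the bracket contributes
  \<open>f\<^sub>1(x\<^sub>4, x\<^sub>5) g\<^sub>1(x\<^sub>1, x\<^sub>2) - g\<^sub>1(x\<^sub>4, x\<^sub>5) f\<^sub>1(x\<^sub>1, x\<^sub>2)\<close> (\<open>lookup_e_bracket\<close>).

  The retained coefficients of \<open>f\<^sub>1\<close> determine \<open>f\<close> (\<open>period_space_eq_0I\<close>): if they all vanish, each
  homogeneous component of \<open>f\<close> is a multiple of some \<open>X\<^sup>D Y\<^sup>2 - X\<^sup>2 Y\<^sup>D\<close>, and the three-term relation
  at the point \<open>(3, 1)\<close> excludes non-zero polynomials of this form. Finally, an alternating map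
  whose coefficients are the minors \<open>\<phi>\<^sub>\<alpha>(f) \<phi>\<^sub>\<beta>(g) - \<phi>\<^sub>\<alpha>(g) \<phi>\<^sub>\<beta>(f)\<close> of a jointly injective family of linear
  functionals \<open>\<phi>\<^sub>\<alpha>\<close> is injective on the exterior square (\<open>extend_gen_eq_0_imp_relation\<close>).
\<close>


section \<open>Sums of monomials\<close>

lemma poly_mapping_sum_single:
  fixes p :: "'a \<Rightarrow>\<^sub>0 'b::comm_monoid_add"
  shows "(\<Sum>k\<in>Poly_Mapping.keys p. Poly_Mapping.single k (Poly_Mapping.lookup p k)) = p"
  by (rule poly_mapping_eqI)
    (auto simp: lookup_sum lookup_single when_def sum.delta in_keys_iff)

lemma poly_mapping_sum_induct [case_names single add]:
  fixes p :: "'a \<Rightarrow>\<^sub>0 'b::comm_monoid_add"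
  assumes "\<And>k c. P (Poly_Mapping.single k c)" and "\<And>p q. P p \<Longrightarrow> P q \<Longrightarrow> P (p + q)"
  shows "P p"
proof -
  have "P (\<Sum>k\<in>A. Poly_Mapping.single k (Poly_Mapping.lookup p k))" if "finite A" for A
    using that
  proof induction
    case empty
    show ?case using assms(1)[of undefined 0] by simp
  qed (simp add: assms)
  from this[of "Poly_Mapping.keys p"] show ?thesis by (simp add: poly_mapping_sum_single)
qed

lemma scl_single: "scl c (Poly_Mapping.single k d) = Poly_Mapping.single k (c * d)"
  by (rule poly_mapping_eqI) (simp add: lookup_single when_def)


section \<open>Maps out of an exterior square\<close>

lemma free2_add: "u \<in> free2 V \<Longrightarrow> v \<in> free2 V \<Longrightarrow> u + v \<in> free2 V"
  using keys_add[of u v] by (auto simp: free2_def)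

lemma free2_scl: "u \<in> free2 V \<Longrightarrow> scl c u \<in> free2 V"
  by (auto simp: free2_def in_keys_iff)

lemma free2_diff: "u \<in> free2 V \<Longrightarrow> v \<in> free2 V \<Longrightarrow> u - v \<in> free2 V"
  using free2_add[of u V "scl (- 1) v"] free2_scl[of v V "- 1"] by simp

lemma gen_in_free2: "f \<in> V \<Longrightarrow> g \<in> V \<Longrightarrow> gen f g \<in> free2 V"
  by (simp add: free2_def gen_def)

lemma ext2_class_eq_iff:
  assumes "u \<in> free2 V" "v \<in> free2 V"
  shows "ext2_class V u = ext2_class V v \<longleftrightarrow> u - v \<in> qvs.span (ext2_relators V)"
proof
  assume "ext2_class V u = ext2_class V v"
  moreover have "v \<in> ext2_class V v"
    using assms by (simp add: ext2_rel_def qvs.span_zero)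
  ultimately have "v \<in> ext2_class V u" by simp
  then show "u - v \<in> qvs.span (ext2_relators V)" by (simp add: ext2_rel_def)
next
  assume uv: "u - v \<in> qvs.span (ext2_relators V)"
  have "u - w \<in> qvs.span (ext2_relators V) \<longleftrightarrow> v - w \<in> qvs.span (ext2_relators V)" for w
    using qvs.span_add_eq[OF uv, of "v - w"] by simp
  then show "ext2_class V u = ext2_class V v"
    using assms by (auto simp: ext2_rel_def)
qed

definition extend_gen :: "('a \<Rightarrow> 'a \<Rightarrow> 'c \<Rightarrow>\<^sub>0 rat) \<Rightarrow> ('a \<times> 'a \<Rightarrow>\<^sub>0 rat) \<Rightarrow> 'c \<Rightarrow>\<^sub>0 rat" where
  "extend_gen br u = (\<Sum>x\<in>Poly_Mapping.keys u. scl (Poly_Mapping.lookup u x) (br (fst x) (snd x)))"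

lemma extend_gen_superset:
  assumes "finite A" "Poly_Mapping.keys u \<subseteq> A"
  shows "extend_gen br u = (\<Sum>x\<in>A. scl (Poly_Mapping.lookup u x) (br (fst x) (snd x)))"
  unfolding extend_gen_def
  by (rule sum.mono_neutral_left) (use assms in \<open>auto simp: in_keys_iff\<close>)

lemma extend_gen_add: "extend_gen br (u + v) = extend_gen br u + extend_gen br v"
proof -
  let ?A = "Poly_Mapping.keys u \<union> Poly_Mapping.keys v"
  have "extend_gen br (u + v) = (\<Sum>x\<in>?A. scl (Poly_Mapping.lookup (u + v) x) (br (fst x) (snd x)))"
    using keys_add[of u v] by (intro extend_gen_superset) auto
  then show ?thesis
    by (simp add: extend_gen_superset[of ?A] lookup_add qvs.scale_left_distrib sum.distrib)
qed

lemma extend_gen_scl: "extend_gen br (scl c u) = scl c (extend_gen br u)"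
  by (subst extend_gen_superset[of "Poly_Mapping.keys u"])
    (auto simp: extend_gen_def qvs.scale_sum_right in_keys_iff)

lemma extend_gen_diff: "extend_gen br (u - v) = extend_gen br u - extend_gen br v"
  using extend_gen_add[of br u "- v"] extend_gen_scl[of br "- 1" v] by simp

lemma extend_gen_gen: "extend_gen br (gen f g) = br f g"
  by (simp add: extend_gen_def gen_def)

text \<open>The universal property of the exterior square: an alternating bilinear map on \<open>V\<close> factors through
  \<open>ext2 V\<close>. Antisymmetry implies alternation here because the coefficients are rational.\<close>

locale alternating_form =
  fixes V :: "('b \<Rightarrow>\<^sub>0 rat) set" and br :: "('b \<Rightarrow>\<^sub>0 rat) \<Rightarrow> ('b \<Rightarrow>\<^sub>0 rat) \<Rightarrow> 'c \<Rightarrow>\<^sub>0 rat"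
  assumes subspace: "qvs.subspace V"
    and add_left: "\<lbrakk>f \<in> V; f' \<in> V; g \<in> V\<rbrakk> \<Longrightarrow> br (f + f') g = br f g + br f' g"
    and scl_left: "\<lbrakk>f \<in> V; g \<in> V\<rbrakk> \<Longrightarrow> br (scl c f) g = scl c (br f g)"
    and antisym: "\<lbrakk>f \<in> V; g \<in> V\<rbrakk> \<Longrightarrow> br g f = - br f g"
begin

abbreviation R where "R \<equiv> qvs.span (ext2_relators V)"

lemma alternating: "f \<in> V \<Longrightarrow> br f f = 0"
proof (rule poly_mapping_eqI)
  fix k assume "f \<in> V"
  from arg_cong[OF antisym[OF this this], of "\<lambda>p. Poly_Mapping.lookup p k"]
  show "Poly_Mapping.lookup (br f f) k = Poly_Mapping.lookup 0 k" by simp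
qed

lemma add_right:
  assumes "f \<in> V" "g \<in> V" "g' \<in> V" shows "br f (g + g') = br f g + br f g'"
  using antisym[of "g + g'" f] antisym[of g f] antisym[of g' f] assms qvs.subspace_add[OF subspace]
  by (simp add: add_left)

lemma scl_right:
  assumes "f \<in> V" "g \<in> V" shows "br f (scl c g) = scl c (br f g)"
  using antisym[of "scl c g" f] antisym[of g f] assms qvs.subspace_scale[OF subspace]
  by (simp add: scl_left)

lemma extend_gen_relators: "w \<in> R \<Longrightarrow> extend_gen br w = 0"
proof (induction rule: qvs.span_induct_alt)
  case (step c r w)
  have "extend_gen br r = 0"
    using step(1) unfolding ext2_relators_def
    by (auto simp: extend_gen_diff extend_gen_scl extend_gen_gen add_left add_right scl_left scl_right alternating)
  then show ?case using step by (simp add: extend_gen_add extend_gen_scl)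
qed (simp add: extend_gen_def)

text \<open>The choice of a representative is immaterial because \<open>extend_gen br\<close> annihilates the relations.\<close>

definition induced :: "(('b \<Rightarrow>\<^sub>0 rat) \<times> ('b \<Rightarrow>\<^sub>0 rat) \<Rightarrow>\<^sub>0 rat) set \<Rightarrow> 'c \<Rightarrow>\<^sub>0 rat" where
  "induced C = extend_gen br (SOME u. u \<in> C)"

lemma induced_class:
  assumes "u \<in> free2 V" shows "induced (ext2_class V u) = extend_gen br u"
proof -
  have "u \<in> ext2_class V u"
    using assms by (simp add: ext2_rel_def qvs.span_zero)
  define w where "w = (SOME v. v \<in> ext2_class V u)"
  have "w \<in> ext2_class V u" unfolding w_def by (rule someI) fact
  then have "u - w \<in> R" by (simp add: ext2_rel_def)
  from extend_gen_relators[OF this] show ?thesis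
    unfolding induced_def w_def[symmetric] by (simp add: extend_gen_diff)
qed

lemma ext2_linear_induced: "ext2_linear V induced"
  by (simp add: ext2_linear_def induced_class free2_add free2_scl extend_gen_add extend_gen_scl)

lemma induced_wedge: "f \<in> V \<Longrightarrow> g \<in> V \<Longrightarrow> induced (wedge V f g) = br f g"
  by (simp add: wedge_def induced_class gen_in_free2 extend_gen_gen)

lemma induced_in:
  assumes "qvs.subspace W" "\<And>f g. f \<in> V \<Longrightarrow> g \<in> V \<Longrightarrow> br f g \<in> W"
  shows "induced \<in> ext2 V \<rightarrow> W"
proof
  fix C assume "C \<in> ext2 V"
  then obtain u where u: "u \<in> free2 V" "C = ext2_class V u" by (auto simp: ext2_def quotient_def)
  have "extend_gen br u \<in> W"
    unfolding extend_gen_def using u(1) assms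
    by (intro qvs.subspace_sum[OF assms(1)] qvs.subspace_scale[OF assms(1)] assms(2)) (auto simp: free2_def)
  then show "induced C \<in> W" using u by (simp add: induced_class)
qed

lemma inj_on_induced:
  assumes "\<And>u. u \<in> free2 V \<Longrightarrow> extend_gen br u = 0 \<Longrightarrow> u \<in> R"
  shows "inj_on induced (ext2 V)"
proof (rule inj_onI)
  fix C D assume "C \<in> ext2 V" "D \<in> ext2 V" and eq: "induced C = induced D"
  then obtain u v where uv: "u \<in> free2 V" "C = ext2_class V u" "v \<in> free2 V" "D = ext2_class V v"
    by (auto simp: ext2_def quotient_def)
  then have "extend_gen br (u - v) = 0"
    using eq by (simp add: extend_gen_diff induced_class)
  then have "u - v \<in> R" using uv by (intro assms free2_diff)
  then show "C = D" using uv by (simp add: ext2_class_eq_iff)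
qed

subsection \<open>Coordinates\<close>

lemma gen_add_left: "\<lbrakk>f \<in> V; f' \<in> V; g \<in> V\<rbrakk> \<Longrightarrow> gen (f + f') g - gen f g - gen f' g \<in> R"
  and gen_add_right: "\<lbrakk>f \<in> V; g \<in> V; g' \<in> V\<rbrakk> \<Longrightarrow> gen f (g + g') - gen f g - gen f g' \<in> R"
  and gen_scl_left: "\<lbrakk>f \<in> V; g \<in> V\<rbrakk> \<Longrightarrow> gen (scl c f) g - scl c (gen f g) \<in> R"
  and gen_scl_right: "\<lbrakk>f \<in> V; g \<in> V\<rbrakk> \<Longrightarrow> gen f (scl c g) - scl c (gen f g) \<in> R"
  and gen_alt: "f \<in> V \<Longrightarrow> gen f f \<in> R"
  unfolding ext2_relators_def by (rule qvs.span_base; blast)+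

lemma gen_swap:
  assumes "f \<in> V" "g \<in> V" shows "gen f g + gen g f \<in> R"
proof -
  have fg: "f + g \<in> V" using assms qvs.subspace_add[OF subspace] by blast
  have "gen (f + g) (f + g) - (gen (f + g) (f + g) - gen f (f + g) - gen g (f + g))
      - (gen f (f + g) - gen f f - gen f g) - (gen g (f + g) - gen g f - gen g g) - gen f f - gen g g \<in> R"
    using assms fg by (intro qvs.span_diff gen_add_left gen_add_right gen_alt)
  then show ?thesis by (simp add: algebra_simps)
qed

lemma gen_sum_left:
  assumes "F \<subseteq> V" "g \<in> V"
  shows "gen (\<Sum>a\<in>F. scl (r a) a) g - (\<Sum>a\<in>F. scl (r a) (gen a g)) \<in> R"
  using assms(1)
proof (induction F rule: infinite_finite_induct)
  case (insert a F)
  let ?s = "\<Sum>a\<in>F. scl (r a) a" and ?t = "\<Sum>a\<in>F. scl (r a) (gen a g)"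
  have V: "scl (r a) a \<in> V" "?s \<in> V"
    using insert.prems by (auto intro!: qvs.subspace_scale[OF subspace] qvs.subspace_sum[OF subspace])
  have "(gen (scl (r a) a + ?s) g - gen (scl (r a) a) g - gen ?s g)
      + (gen (scl (r a) a) g - scl (r a) (gen a g)) + (gen ?s g - ?t) \<in> R"
    using insert V assms(2) by (intro qvs.span_add gen_add_left gen_scl_left) auto
  then show ?case using insert.hyps by (simp add: algebra_simps)
qed (use gen_scl_left[of 0 g 0] assms(2) qvs.subspace_0[OF subspace] in simp_all)

lemma gen_sum_right:
  assumes "F \<subseteq> V" "g \<in> V"
  shows "gen g (\<Sum>a\<in>F. scl (r a) a) - (\<Sum>a\<in>F. scl (r a) (gen g a)) \<in> R"
  using assms(1)
proof (induction F rule: infinite_finite_induct)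
  case (insert a F)
  let ?s = "\<Sum>a\<in>F. scl (r a) a" and ?t = "\<Sum>a\<in>F. scl (r a) (gen g a)"
  have V: "scl (r a) a \<in> V" "?s \<in> V"
    using insert.prems by (auto intro!: qvs.subspace_scale[OF subspace] qvs.subspace_sum[OF subspace])
  have "(gen g (scl (r a) a + ?s) - gen g (scl (r a) a) - gen g ?s)
      + (gen g (scl (r a) a) - scl (r a) (gen g a)) + (gen g ?s - ?t) \<in> R"
    using insert V assms(2) by (intro qvs.span_add gen_add_right gen_scl_right) auto
  then show ?case using insert.hyps by (simp add: algebra_simps)
qed (use gen_scl_right[of g 0 0] assms(2) qvs.subspace_0[OF subspace] in simp_all)

lemma gen_sum:
  assumes F: "F \<subseteq> V" and fg: "f \<in> V" "g \<in> V" "f = (\<Sum>a\<in>F. scl (r a) a)" "g = (\<Sum>b\<in>F. scl (s b) b)"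
  shows "gen f g - (\<Sum>a\<in>F. \<Sum>b\<in>F. scl (r a * s b) (gen a b)) \<in> R"
proof -
  have "(gen f g - (\<Sum>a\<in>F. scl (r a) (gen a g)))
      + (\<Sum>a\<in>F. scl (r a) (gen a g - (\<Sum>b\<in>F. scl (s b) (gen a b)))) \<in> R"
    using gen_sum_left[OF F fg(2), of r] gen_sum_right[OF F, of _ s] F
    by (intro qvs.span_add qvs.span_sum qvs.span_scale) (auto simp flip: fg(3,4))
  then show ?thesis
    by (simp add: qvs.scale_right_diff_distrib sum_subtractf qvs.scale_sum_right)
qed

text \<open>A symmetric combination is a relation because each \<open>gen a b + gen b a\<close> is one; the factor two that
  arises from adding the combination to its transpose is invertible.\<close>

lemma symmetric_combination:
  assumes F: "F \<subseteq> V" and c: "\<And>a b. a \<in> F \<Longrightarrow> b \<in> F \<Longrightarrow> c a b = c b a"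
  shows "(\<Sum>a\<in>F. \<Sum>b\<in>F. scl (c a b) (gen a b)) \<in> R"
proof -
  let ?S = "\<Sum>a\<in>F. \<Sum>b\<in>F. scl (c a b) (gen a b)"
  have "?S = (\<Sum>b\<in>F. \<Sum>a\<in>F. scl (c a b) (gen a b))" by (rule sum.swap)
  also have "\<dots> = (\<Sum>a\<in>F. \<Sum>b\<in>F. scl (c a b) (gen b a))"
    using c by (intro sum.cong) auto
  finally have "?S + ?S = (\<Sum>a\<in>F. \<Sum>b\<in>F. scl (c a b) (gen a b + gen b a))"
    by (simp add: qvs.scale_right_distrib sum.distrib)
  also have "\<dots> \<in> R"
    using F by (intro qvs.span_sum qvs.span_scale gen_swap) auto
  finally have "scl (1 / 2) (?S + ?S) \<in> R" by (rule qvs.span_scale)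
  also have "scl (1 / 2) (?S + ?S) = ?S"
    by (rule poly_mapping_eqI) (simp only: lookup_scl lookup_add field_sum_of_halves distrib_left)
  finally show ?thesis .
qed

text \<open>Expand all vectors that occur in \<open>u\<close> in a basis. Modulo the relations, \<open>u\<close> is a combination
  \<open>\<Sum> c a b (gen a b)\<close> of pairs of basis vectors, and \<open>extend_gen br u = 0\<close> says that the
  antisymmetric matrix \<open>c a b - c b a\<close> is annihilated by all \<open>\<phi> \<alpha> \<otimes> \<phi> \<beta>\<close>. Joint injectivity
  of the \<open>\<phi> \<alpha>\<close>, used for one tensor factor at a time, forces this matrix to be zero. Then \<open>c\<close>
  is symmetric and \<open>u\<close> is a relation.\<close>

lemma extend_gen_eq_0_imp_relation:
  assumes \<phi>_add: "\<And>\<alpha> f g. \<lbrakk>\<alpha> \<in> I; f \<in> V; g \<in> V\<rbrakk> \<Longrightarrow> \<phi> \<alpha> (f + g) = \<phi> \<alpha> f + \<phi> \<alpha> g"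
    and \<phi>_scl: "\<And>\<alpha> c f. \<lbrakk>\<alpha> \<in> I; f \<in> V\<rbrakk> \<Longrightarrow> \<phi> \<alpha> (scl c f) = c * \<phi> \<alpha> f"
    and \<phi>_inj: "\<And>f. \<lbrakk>f \<in> V; \<And>\<alpha>. \<alpha> \<in> I \<Longrightarrow> \<phi> \<alpha> f = 0\<rbrakk> \<Longrightarrow> f = 0"
    and coeff: "\<And>\<alpha> \<beta> f g. \<lbrakk>\<alpha> \<in> I; \<beta> \<in> I; f \<in> V; g \<in> V\<rbrakk> \<Longrightarrow>
      Poly_Mapping.lookup (br f g) (\<mu> \<alpha> \<beta>) = \<phi> \<alpha> f * \<phi> \<beta> g - \<phi> \<alpha> g * \<phi> \<beta> f"
    and u: "u \<in> free2 V" "extend_gen br u = 0"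
  shows "u \<in> R"
proof -
  obtain B where B: "B \<subseteq> V" "qvs.independent B" "V \<subseteq> qvs.span B"
    using qvs.maximal_independent_subset by metis
  let ?rep = "qvs.representation B" and ?K = "Poly_Mapping.keys u"
  define F where "F = (\<Union>x\<in>?K. {b. ?rep (fst x) b \<noteq> 0} \<union> {b. ?rep (snd x) b \<noteq> 0})"
  have "finite F"
    unfolding F_def by (auto simp: qvs.finite_representation)
  have "F \<subseteq> B" unfolding F_def by (auto dest: qvs.representation_ne_zero)
  then have "F \<subseteq> V" using B by auto
  have expand: "f = (\<Sum>b\<in>F. scl (?rep f b) b)" if "f \<in> V" "{b. ?rep f b \<noteq> 0} \<subseteq> F" for f
  proof -
    have "f = (\<Sum>b | ?rep f b \<noteq> 0. scl (?rep f b) b)"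
      using that B qvs.sum_nonzero_representation_eq[of B f] by auto
    also have "\<dots> = (\<Sum>b\<in>F. scl (?rep f b) b)"
      by (rule sum.mono_neutral_left) (use that \<open>finite F\<close> in auto)
    finally show ?thesis .
  qed
  have K: "fst x \<in> V" "snd x \<in> V" "fst x = (\<Sum>b\<in>F. scl (?rep (fst x) b) b)"
    "snd x = (\<Sum>b\<in>F. scl (?rep (snd x) b) b)" if "x \<in> ?K" for x
  proof -
    show V: "fst x \<in> V" "snd x \<in> V" using that u(1) by (auto simp: free2_def)
    show "fst x = (\<Sum>b\<in>F. scl (?rep (fst x) b) b)"
      by (rule expand[OF V(1)]) (use that in \<open>auto simp: F_def\<close>)
    show "snd x = (\<Sum>b\<in>F. scl (?rep (snd x) b) b)"
      by (rule expand[OF V(2)]) (use that in \<open>auto simp: F_def\<close>)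
  qed
  define c where "c a b = (\<Sum>x\<in>?K. Poly_Mapping.lookup u x * (?rep (fst x) a * ?rep (snd x) b))" for a b
  have \<phi>_sum: "\<phi> \<alpha> (\<Sum>b\<in>F. scl (r b) b) = (\<Sum>b\<in>F. r b * \<phi> \<alpha> b)" if \<alpha>: "\<alpha> \<in> I" for \<alpha> r
    using \<open>finite F\<close> \<open>F \<subseteq> V\<close>
  proof (induction F)
    case empty
    show ?case using \<phi>_scl[OF \<alpha>, of 0 0] qvs.subspace_0[OF subspace] by simp
  next
    case (insert a F)
    then show ?case
      by (simp add: \<phi>_add[OF \<alpha>] \<phi>_scl[OF \<alpha>] qvs.subspace_scale[OF subspace] qvs.subspace_sum[OF subspace] subset_iff)
  qed
  have sum_V: "(\<Sum>b\<in>F. scl (r b) b) \<in> V" for r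
    using \<open>F \<subseteq> V\<close> by (auto intro!: qvs.subspace_sum[OF subspace] qvs.subspace_scale[OF subspace])
  \<comment> \<open>The functionals restricted to the finite set \<open>F\<close> of basis vectors still separate linear combinations.\<close>
  have indep: "r b = 0" if "\<And>\<alpha>. \<alpha> \<in> I \<Longrightarrow> (\<Sum>b\<in>F. r b * \<phi> \<alpha> b) = 0" "b \<in> F" for r b
  proof -
    have "(\<Sum>b\<in>F. scl (r b) b) = 0" using that(1) by (intro \<phi>_inj sum_V) (simp add: \<phi>_sum)
    then show ?thesis using qvs.independentD[OF B(2) \<open>finite F\<close> \<open>F \<subseteq> B\<close>] that(2) by blast
  qed
  have vanish: "(\<Sum>a\<in>F. (\<Sum>b\<in>F. (c a b - c b a) * \<phi> \<beta> b) * \<phi> \<alpha> a) = 0"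
    if I: "\<alpha> \<in> I" "\<beta> \<in> I" for \<alpha> \<beta>
  proof -
    have prod: "\<phi> \<alpha> (fst x) * \<phi> \<beta> (snd x) - \<phi> \<alpha> (snd x) * \<phi> \<beta> (fst x) =
        (\<Sum>a\<in>F. \<Sum>b\<in>F. (?rep (fst x) a * ?rep (snd x) b - ?rep (fst x) b * ?rep (snd x) a) * (\<phi> \<alpha> a * \<phi> \<beta> b))"
      if "x \<in> ?K" for x
    proof -
      have 1: "\<phi> \<alpha> (fst x) = (\<Sum>b\<in>F. ?rep (fst x) b * \<phi> \<alpha> b)" "\<phi> \<alpha> (snd x) = (\<Sum>b\<in>F. ?rep (snd x) b * \<phi> \<alpha> b)"
        if "\<alpha> \<in> I" for \<alpha>
        using arg_cong[OF K(3)[OF \<open>x \<in> ?K\<close>], of "\<phi> \<alpha>"] arg_cong[OF K(4)[OF \<open>x \<in> ?K\<close>], of "\<phi> \<alpha>"]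
        by (simp_all only: \<phi>_sum[OF that])
      show ?thesis
        unfolding 1[OF I(1)] 1[OF I(2)] sum_product sum_subtractf[symmetric]
        by (intro sum.cong refl) (simp add: algebra_simps)
    qed
    have "0 = Poly_Mapping.lookup (extend_gen br u) (\<mu> \<alpha> \<beta>)" using u by simp
    also have "\<dots> = (\<Sum>x\<in>?K. Poly_Mapping.lookup u x * (\<phi> \<alpha> (fst x) * \<phi> \<beta> (snd x) - \<phi> \<alpha> (snd x) * \<phi> \<beta> (fst x)))"
      using K(1,2) I by (simp add: extend_gen_def lookup_sum coeff)
    also have "\<dots> = (\<Sum>x\<in>?K. \<Sum>a\<in>F. \<Sum>b\<in>F. Poly_Mapping.lookup u x *
        ((?rep (fst x) a * ?rep (snd x) b - ?rep (fst x) b * ?rep (snd x) a) * (\<phi> \<alpha> a * \<phi> \<beta> b)))"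
      by (simp add: prod sum_distrib_left)
    also have "\<dots> = (\<Sum>a\<in>F. \<Sum>b\<in>F. \<Sum>x\<in>?K. Poly_Mapping.lookup u x *
        ((?rep (fst x) a * ?rep (snd x) b - ?rep (fst x) b * ?rep (snd x) a) * (\<phi> \<alpha> a * \<phi> \<beta> b)))"
      by (subst sum.swap, rule sum.cong[OF refl], rule sum.swap)
    also have "\<dots> = (\<Sum>a\<in>F. \<Sum>b\<in>F. (c a b - c b a) * (\<phi> \<alpha> a * \<phi> \<beta> b))"
      by (intro sum.cong refl)
        (simp add: c_def sum_distrib_right right_diff_distrib left_diff_distrib sum_subtractf mult.assoc)
    also have "\<dots> = (\<Sum>a\<in>F. (\<Sum>b\<in>F. (c a b - c b a) * \<phi> \<beta> b) * \<phi> \<alpha> a)"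
      by (simp add: sum_distrib_right sum_distrib_left ac_simps)
    finally show ?thesis by simp
  qed
  have sym: "c a b = c b a" if ab: "a \<in> F" "b \<in> F" for a b
  proof -
    have "(\<Sum>b\<in>F. (c a b - c b a) * \<phi> \<beta> b) = 0" if "\<beta> \<in> I" for \<beta>
      by (rule indep[of "\<lambda>a. \<Sum>b\<in>F. (c a b - c b a) * \<phi> \<beta> b", OF vanish[OF _ that] ab(1)])
    then have "c a b - c b a = 0" by (rule indep[of "\<lambda>b. c a b - c b a", OF _ ab(2)])
    then show ?thesis by simp
  qed
  have "u = (\<Sum>x\<in>?K. scl (Poly_Mapping.lookup u x) (gen (fst x) (snd x)))"
    by (simp add: gen_def scl_single poly_mapping_sum_single)
  moreover have "(\<Sum>a\<in>F. \<Sum>b\<in>F. scl (c a b) (gen a b)) =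
      (\<Sum>x\<in>?K. scl (Poly_Mapping.lookup u x) (\<Sum>a\<in>F. \<Sum>b\<in>F. scl (?rep (fst x) a * ?rep (snd x) b) (gen a b)))"
    unfolding c_def qvs.scale_sum_left qvs.scale_sum_right qvs.scale_scale
    by (simp only: sum.swap[where A = ?K and B = F])
  ultimately have "u - (\<Sum>a\<in>F. \<Sum>b\<in>F. scl (c a b) (gen a b)) =
      (\<Sum>x\<in>?K. scl (Poly_Mapping.lookup u x) (gen (fst x) (snd x) -
        (\<Sum>a\<in>F. \<Sum>b\<in>F. scl (?rep (fst x) a * ?rep (snd x) b) (gen a b))))"
    by (simp only: qvs.scale_right_diff_distrib sum_subtractf)
  also have "\<dots> \<in> R"
    by (intro qvs.span_sum qvs.span_scale gen_sum[OF \<open>F \<subseteq> V\<close>] K)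
  finally have "u - (\<Sum>a\<in>F. \<Sum>b\<in>F. scl (c a b) (gen a b)) + (\<Sum>a\<in>F. \<Sum>b\<in>F. scl (c a b) (gen a b)) \<in> R"
    by (intro qvs.span_add symmetric_combination \<open>F \<subseteq> V\<close> sym)
  then show ?thesis by simp
qed

end

section \<open>Substitution homomorphisms\<close>

definition subst_mon :: "(nat \<Rightarrow> mpol) \<Rightarrow> (nat \<Rightarrow>\<^sub>0 nat) \<Rightarrow> mpol" where
  "subst_mon \<sigma> m = (\<Prod>i\<in>Poly_Mapping.keys m. \<sigma> i ^ Poly_Mapping.lookup m i)"

text \<open>The substitution underlying \<open>psubst\<close>, but with a value for every variable, so that it is a
  ring homomorphism and two substitutions can be composed.\<close>

definition subst :: "(nat \<Rightarrow> mpol) \<Rightarrow> mpol \<Rightarrow> mpol" where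
  "subst \<sigma> p = (\<Sum>m\<in>Poly_Mapping.keys p. scl (Poly_Mapping.lookup p m) (subst_mon \<sigma> m))"

lemma psubst_eq_subst: "psubst p as = subst ((!) as) p"
  by (simp add: psubst_def subst_def subst_mon_def)

lemma scl_eq_mult: "scl c p = Poly_Mapping.single 0 c * (p :: mpol)"
  by (simp add: scl_def mult_map_scale_conv_mult)

lemma scl_mult_left: "scl c p * (q :: mpol) = scl c (p * q)"
  by (simp add: scl_eq_mult mult.assoc)

lemma scl_mult_right: "(q :: mpol) * scl c p = scl c (q * p)"
  by (simp add: scl_eq_mult ac_simps)

lemma subst_mon_superset:
  assumes "finite A" "Poly_Mapping.keys m \<subseteq> A"
  shows "subst_mon \<sigma> m = (\<Prod>i\<in>A. \<sigma> i ^ Poly_Mapping.lookup m i)"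
  unfolding subst_mon_def
  by (rule prod.mono_neutral_left) (use assms in \<open>auto simp: in_keys_iff\<close>)

lemma subst_mon_0 [simp]: "subst_mon \<sigma> 0 = 1"
  by (simp add: subst_mon_def)

lemma subst_mon_single [simp]: "subst_mon \<sigma> (Poly_Mapping.single i k) = \<sigma> i ^ k"
  by (simp add: subst_mon_def)

lemma subst_mon_add: "subst_mon \<sigma> (m + m') = subst_mon \<sigma> m * subst_mon \<sigma> m'"
proof -
  let ?A = "Poly_Mapping.keys m \<union> Poly_Mapping.keys m'"
  have "subst_mon \<sigma> (m + m') = (\<Prod>i\<in>?A. \<sigma> i ^ Poly_Mapping.lookup (m + m') i)"
    using keys_add[of m m'] by (intro subst_mon_superset) auto
  also have "\<dots> = (\<Prod>i\<in>?A. \<sigma> i ^ Poly_Mapping.lookup m i) * (\<Prod>i\<in>?A. \<sigma> i ^ Poly_Mapping.lookup m' i)"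
    by (simp add: lookup_add power_add prod.distrib)
  also have "\<dots> = subst_mon \<sigma> m * subst_mon \<sigma> m'"
    by (simp add: subst_mon_superset[of ?A])
  finally show ?thesis .
qed

lemma subst_superset:
  assumes "finite A" "Poly_Mapping.keys p \<subseteq> A"
  shows "subst \<sigma> p = (\<Sum>m\<in>A. scl (Poly_Mapping.lookup p m) (subst_mon \<sigma> m))"
  unfolding subst_def
  by (rule sum.mono_neutral_left) (use assms in \<open>auto simp: in_keys_iff\<close>)

lemma subst_single [simp]: "subst \<sigma> (Poly_Mapping.single m c) = scl c (subst_mon \<sigma> m)"
  by (subst subst_superset[of "{m}"]) auto

lemma subst_0 [simp]: "subst \<sigma> 0 = 0"
  by (simp add: subst_def)

lemma subst_1 [simp]: "subst \<sigma> 1 = 1"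
  by (subst single_one[symmetric], subst subst_single) simp

lemma subst_Var [simp]: "subst \<sigma> (Var i) = \<sigma> i"
  by (simp add: Var_def)

lemma subst_add [simp]: "subst \<sigma> (p + q) = subst \<sigma> p + subst \<sigma> q"
proof -
  let ?A = "Poly_Mapping.keys p \<union> Poly_Mapping.keys q"
  have "subst \<sigma> (p + q) = (\<Sum>m\<in>?A. scl (Poly_Mapping.lookup (p + q) m) (subst_mon \<sigma> m))"
    using keys_add[of p q] by (intro subst_superset) auto
  then show ?thesis
    by (simp add: subst_superset[of ?A] lookup_add qvs.scale_left_distrib sum.distrib)
qed

lemma subst_scl [simp]: "subst \<sigma> (scl c p) = scl c (subst \<sigma> p)"
proof (induction p rule: poly_mapping_sum_induct)
  case (single m d)
  then show ?case by (simp add: scl_single)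
qed (simp add: qvs.scale_right_distrib)

lemma subst_uminus [simp]: "subst \<sigma> (- p) = - subst \<sigma> p"
  by (metis add_eq_0_iff add.right_inverse subst_0 subst_add)

lemma subst_diff [simp]: "subst \<sigma> (p - q) = subst \<sigma> p - subst \<sigma> q"
  by (metis subst_add subst_uminus uminus_add_conv_diff add.commute)

lemma subst_mult [simp]: "subst \<sigma> (p * q) = subst \<sigma> p * subst \<sigma> q"
proof (induction p rule: poly_mapping_sum_induct)
  case (single m c)
  show ?case
  proof (induction q rule: poly_mapping_sum_induct)
    case (single m' c')
    then show ?case
      by (simp add: mult_single subst_mon_add scl_mult_left scl_mult_right ac_simps)
  qed (simp add: distrib_left)
qed (simp add: distrib_right)

lemma subst_sum [simp]: "subst \<sigma> (sum h A) = (\<Sum>x\<in>A. subst \<sigma> (h x))"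
  by (induction A rule: infinite_finite_induct) auto

lemma subst_prod [simp]: "subst \<sigma> (prod h A) = (\<Prod>x\<in>A. subst \<sigma> (h x))"
  by (induction A rule: infinite_finite_induct) auto

lemma subst_power [simp]: "subst \<sigma> (p ^ n) = subst \<sigma> p ^ n"
  by (induction n) auto

lemma subst_subst: "subst \<tau> (subst \<sigma> p) = subst (\<lambda>i. subst \<tau> (\<sigma> i)) p"
proof (induction p rule: poly_mapping_sum_induct)
  case (single m c)
  then show ?case by (simp add: subst_mon_def)
qed simp

lemma subst_cong:
  assumes "p \<in> polys_in V" "\<And>i. i \<in> V \<Longrightarrow> \<sigma> i = \<tau> i"
  shows "subst \<sigma> p = subst \<tau> p"
proof -
  have "subst_mon \<sigma> m = subst_mon \<tau> m" if "m \<in> Poly_Mapping.keys p" for m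
  proof -
    have "Poly_Mapping.keys m \<subseteq> V" using assms(1) that by (simp add: polys_in_def)
    then show ?thesis
      unfolding subst_mon_def using assms(2) by (intro prod.cong) auto
  qed
  then show ?thesis by (simp add: subst_def)
qed

subsection \<open>Polynomials in a given set of variables\<close>

lemma polys_in_0 [simp]: "0 \<in> polys_in V" and polys_in_1 [simp]: "1 \<in> polys_in V"
  by (auto simp: polys_in_def)

lemma polys_in_Var [simp]: "Var i \<in> polys_in V \<longleftrightarrow> i \<in> V"
  by (auto simp: polys_in_def Var_def)

lemma polys_in_add: "p \<in> polys_in V \<Longrightarrow> q \<in> polys_in V \<Longrightarrow> p + q \<in> polys_in V"
  using keys_add[of p q] by (auto simp: polys_in_def)

lemma polys_in_scl: "p \<in> polys_in V \<Longrightarrow> scl c p \<in> polys_in V"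
  by (auto simp: polys_in_def in_keys_iff)

lemma polys_in_uminus: "p \<in> polys_in V \<Longrightarrow> - p \<in> polys_in V"
  by (auto simp: polys_in_def in_keys_iff)

lemma polys_in_diff: "p \<in> polys_in V \<Longrightarrow> q \<in> polys_in V \<Longrightarrow> p - q \<in> polys_in V"
  using polys_in_add[of p V "- q"] polys_in_uminus[of q V] by simp

lemma polys_in_mult:
  assumes "p \<in> polys_in V" "q \<in> polys_in V" shows "p * q \<in> polys_in V"
  unfolding polys_in_def
proof (intro CollectI ballI)
  fix m assume "m \<in> Poly_Mapping.keys (p * q)"
  then obtain a b where "a \<in> Poly_Mapping.keys p" "b \<in> Poly_Mapping.keys q" "m = a + b"
    using keys_mult[of p q] by auto
  then show "Poly_Mapping.keys m \<subseteq> V"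
    using assms keys_add[of a b] unfolding polys_in_def by fast
qed

lemma polys_in_power: "p \<in> polys_in V \<Longrightarrow> p ^ n \<in> polys_in V"
  by (induction n) (auto intro: polys_in_mult)

lemma polys_in_sum: "(\<And>x. x \<in> A \<Longrightarrow> h x \<in> polys_in V) \<Longrightarrow> sum h A \<in> polys_in V"
  by (induction A rule: infinite_finite_induct) (auto intro: polys_in_add)

lemma polys_in_prod: "(\<And>x. x \<in> A \<Longrightarrow> h x \<in> polys_in V) \<Longrightarrow> prod h A \<in> polys_in V"
  by (induction A rule: infinite_finite_induct) (auto intro: polys_in_mult)

lemma polys_in_subst:
  assumes "p \<in> polys_in V" "\<And>i. i \<in> V \<Longrightarrow> \<sigma> i \<in> polys_in W"
  shows "subst \<sigma> p \<in> polys_in W"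
  unfolding subst_def subst_mon_def
proof (intro polys_in_sum polys_in_scl polys_in_prod polys_in_power)
  fix m i assume "m \<in> Poly_Mapping.keys p" "i \<in> Poly_Mapping.keys m"
  then have "i \<in> V" using assms(1) by (auto simp: polys_in_def)
  then show "\<sigma> i \<in> polys_in W" by (rule assms(2))
qed

subsection \<open>Rescaling the variables\<close>

lemma subst_mon_Var: "subst_mon Var m = Poly_Mapping.single m 1"
proof -
  have pw: "Var i ^ k = Poly_Mapping.single (Poly_Mapping.single i k) 1" for i k
    by (induction k) (simp_all add: Var_def mult_single single_add[symmetric])
  have pr: "(\<Prod>i\<in>A. Poly_Mapping.single (h i) (1::rat)) = Poly_Mapping.single (\<Sum>i\<in>A. h i) 1"
    if "finite A" for A and h :: "nat \<Rightarrow> nat \<Rightarrow>\<^sub>0 nat"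
    using that by induction (simp_all add: mult_single)
  show ?thesis
    by (simp add: subst_mon_def pw pr poly_mapping_sum_single)
qed

lemma subst_Var_id [simp]: "subst Var p = p"
  by (simp add: subst_def subst_mon_Var scl_single poly_mapping_sum_single)

lemma subst_id: "p \<in> polys_in V \<Longrightarrow> (\<And>i. i \<in> V \<Longrightarrow> \<sigma> i = Var i) \<Longrightarrow> subst \<sigma> p = p"
  using subst_cong[of p V \<sigma> Var] by simp

lemma scl_power: "scl a p ^ n = scl (a ^ n) (p ^ n :: mpol)"
  by (induction n) (simp_all add: scl_mult_left scl_mult_right ac_simps)

lemma scl_prod: "(\<Prod>i\<in>A. scl (a i) (h i :: mpol)) = scl (\<Prod>i\<in>A. a i) (\<Prod>i\<in>A. h i)"
  by (induction A rule: infinite_finite_induct)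
    (simp_all add: scl_mult_left scl_mult_right ac_simps)

text \<open>Sign changes of variables and setting variables to zero are both instances. Parity and
  support of a polynomial are thereby read off from its behaviour under a homomorphism.\<close>

lemma lookup_subst_scl_Var:
  "Poly_Mapping.lookup (subst (\<lambda>i. scl (s i) (Var i)) p) m =
     (\<Prod>i\<in>Poly_Mapping.keys m. s i ^ Poly_Mapping.lookup m i) * Poly_Mapping.lookup p m"
proof (induction p rule: poly_mapping_sum_induct)
  case (single m' c)
  have "subst_mon (\<lambda>i. scl (s i) (Var i)) m' =
      scl (\<Prod>i\<in>Poly_Mapping.keys m'. s i ^ Poly_Mapping.lookup m' i) (subst_mon Var m')"
    by (simp add: subst_mon_def scl_power scl_prod)
  then show ?case
    by (auto simp: subst_mon_Var lookup_single when_def)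
qed (simp add: lookup_add distrib_left)

lemma subst_mon_scale: "subst_mon (\<lambda>i. t * \<sigma> i) m = t ^ mdeg m * subst_mon \<sigma> m"
  by (simp add: subst_mon_def mdeg_def power_mult_distrib prod.distrib power_sum)

lemma homogeneous_subst_scale:
  assumes "homogeneous d p"
  shows "subst (\<lambda>i. t * \<sigma> i) p = t ^ d * subst \<sigma> p"
  using assms
  by (auto simp: subst_def subst_mon_scale sum_distrib_left scl_mult_right homogeneous_def intro!: sum.cong)

section \<open>Coefficients\<close>

abbreviation flip :: "nat \<Rightarrow> nat \<Rightarrow> mpol" where
  "flip v \<equiv> \<lambda>i. if i = v then - Var i else Var i"

lemma lookup_flip:
  "Poly_Mapping.lookup (subst (flip v) p) m =
     (- 1) ^ Poly_Mapping.lookup m v * Poly_Mapping.lookup p m"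
proof -
  have "flip v = (\<lambda>i. scl (if i = v then - 1 else 1) (Var i))"
    by (auto simp: fun_eq_iff)
  moreover have "(\<Prod>i\<in>Poly_Mapping.keys m. (if i = v then - 1 else 1 :: rat) ^ Poly_Mapping.lookup m i)
      = (\<Prod>i\<in>Poly_Mapping.keys m. if i = v then (- 1) ^ Poly_Mapping.lookup m v else 1)"
    by (intro prod.cong) auto
  moreover have "\<dots> = (- 1) ^ Poly_Mapping.lookup m v"
    by (auto simp: prod.delta in_keys_iff)
  ultimately show ?thesis by (simp only: lookup_subst_scl_Var)
qed

lemma lookup_eq_0_if_flip_invariant:
  assumes "subst (flip v) p = p" "odd (Poly_Mapping.lookup m v)"
  shows "Poly_Mapping.lookup p m = 0"
  using lookup_flip[of v p m] assms by simp

lemma lookup_negate: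
  "Poly_Mapping.lookup (subst (\<lambda>i. - Var i) p) m = (- 1) ^ mdeg m * Poly_Mapping.lookup p m"
proof -
  have "(\<lambda>i. - Var i) = (\<lambda>i. scl (- 1) (Var i))"
    by (auto simp: fun_eq_iff)
  then show ?thesis
    by (simp only: lookup_subst_scl_Var mdeg_def power_sum)
qed

lemma lookup_restrict:
  assumes "Poly_Mapping.keys m \<subseteq> V"
  shows "Poly_Mapping.lookup (subst (\<lambda>i. if i \<in> V then Var i else 0) p) m = Poly_Mapping.lookup p m"
proof -
  have "(\<lambda>i. if i \<in> V then Var i else 0) = (\<lambda>i. scl (if i \<in> V then 1 else 0) (Var i))"
    by (auto simp: fun_eq_iff)
  moreover have "(\<Prod>i\<in>Poly_Mapping.keys m. (if i \<in> V then 1 else 0 :: rat) ^ Poly_Mapping.lookup m i) = 1"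
    using assms by (intro prod.neutral) auto
  ultimately show ?thesis by (simp only: lookup_subst_scl_Var)
qed

lemma lookup_eq_0_if_free:
  assumes "p \<in> polys_in (- {v})" "Poly_Mapping.lookup m v \<noteq> 0"
  shows "Poly_Mapping.lookup p m = 0"
proof (rule ccontr)
  assume "Poly_Mapping.lookup p m \<noteq> 0"
  then have "Poly_Mapping.keys m \<subseteq> - {v}"
    using assms(1) by (simp add: polys_in_def in_keys_iff)
  then show False using assms(2) by (auto simp: in_keys_iff)
qed

lemma lookup_eq_0_if_linear:
  assumes "p \<in> polys_in (- {v})" "Poly_Mapping.lookup m v \<ge> 2"
  shows "Poly_Mapping.lookup (Var v * p) m = 0"
proof (rule ccontr)
  assume "Poly_Mapping.lookup (Var v * p) m \<noteq> 0"
  then have "m \<in> Poly_Mapping.keys (Var v * p)" by (simp add: in_keys_iff)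
  then obtain b where b: "b \<in> Poly_Mapping.keys p" "m = Poly_Mapping.single v 1 + b"
    using keys_mult[of "Var v" p] by (auto simp: Var_def)
  have "Poly_Mapping.lookup b v = 0"
    using assms(1) b(1) by (force simp: polys_in_def in_keys_iff)
  then show False using assms(2) b(2) by (simp add: lookup_add)
qed

lemma lookup_mult_disjoint:
  assumes p: "p \<in> polys_in A" and q: "q \<in> polys_in B" and AB: "A \<inter> B = {}"
    and a: "Poly_Mapping.keys a \<subseteq> A" and b: "Poly_Mapping.keys b \<subseteq> B"
  shows "Poly_Mapping.lookup (p * q) (a + b) = Poly_Mapping.lookup p a * Poly_Mapping.lookup q b"
proof -
  have split: "k + l = a + b \<longleftrightarrow> k = a \<and> l = b"
    if "k \<in> Poly_Mapping.keys p" "l \<in> Poly_Mapping.keys q" for k l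
  proof
    assume eq: "k + l = a + b"
    have k: "Poly_Mapping.keys k \<subseteq> A" and l: "Poly_Mapping.keys l \<subseteq> B"
      using p q that by (auto simp: polys_in_def)
    have "Poly_Mapping.lookup k i = Poly_Mapping.lookup a i \<and> Poly_Mapping.lookup l i = Poly_Mapping.lookup b i" for i
    proof -
      have "Poly_Mapping.lookup k i + Poly_Mapping.lookup l i = Poly_Mapping.lookup a i + Poly_Mapping.lookup b i"
        using eq by (metis lookup_add)
      moreover have "i \<notin> A \<Longrightarrow> Poly_Mapping.lookup k i = 0 \<and> Poly_Mapping.lookup a i = 0"
        and "i \<notin> B \<Longrightarrow> Poly_Mapping.lookup l i = 0 \<and> Poly_Mapping.lookup b i = 0"
        using k l a b by (auto simp: in_keys_iff subset_iff)
      moreover have "i \<notin> A \<or> i \<notin> B"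
        using AB by auto
      ultimately show ?thesis by auto
    qed
    then show "k = a \<and> l = b" by (auto intro: poly_mapping_eqI)
  qed auto
  have "p * q = (\<Sum>k\<in>Poly_Mapping.keys p. \<Sum>l\<in>Poly_Mapping.keys q.
      Poly_Mapping.single (k + l) (Poly_Mapping.lookup p k * Poly_Mapping.lookup q l))"
    by (subst (1) poly_mapping_sum_single[of p, symmetric], subst (1) poly_mapping_sum_single[of q, symmetric])
      (simp add: sum_product mult_single)
  then have "Poly_Mapping.lookup (p * q) (a + b) =
      (\<Sum>k\<in>Poly_Mapping.keys p. \<Sum>l\<in>Poly_Mapping.keys q.
        if k = a then (if l = b then Poly_Mapping.lookup p a * Poly_Mapping.lookup q b else 0) else 0)"
    by (auto simp: lookup_sum lookup_single when_def split intro!: sum.cong)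
  also have "\<dots> = (\<Sum>k\<in>Poly_Mapping.keys p. if k = a then
      (\<Sum>l\<in>Poly_Mapping.keys q. if l = b then Poly_Mapping.lookup p a * Poly_Mapping.lookup q b else 0) else 0)"
    by (intro sum.cong) auto
  also have "\<dots> = Poly_Mapping.lookup p a * Poly_Mapping.lookup q b"
    by (auto simp: sum.delta in_keys_iff)
  finally show ?thesis .
qed

subsection \<open>Polynomials in two variables\<close>

lemma psubst_add [simp]: "psubst (p + q) as = psubst p as + psubst q as"
  and psubst_diff [simp]: "psubst (p - q) as = psubst p as - psubst q as"
  and psubst_uminus [simp]: "psubst (- p) as = - psubst p as"
  and psubst_mult [simp]: "psubst (p * q) as = psubst p as * psubst q as"
  and psubst_scl [simp]: "psubst (scl c p) as = scl c (psubst p as)"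
  and psubst_sum [simp]: "psubst (sum h A) as = (\<Sum>x\<in>A. psubst (h x) as)"
  and psubst_Var [simp]: "psubst (Var i) as = as ! i"
  and psubst_0 [simp]: "psubst 0 as = 0"
  by (simp_all add: psubst_eq_subst)

lemma subst_psubst:
  assumes "p \<in> polys_in {..<length as}"
  shows "subst \<tau> (psubst p as) = psubst p (map (subst \<tau>) as)"
  unfolding psubst_eq_subst subst_subst by (rule subst_cong[OF assms]) simp

lemma psubst_map_psubst:
  assumes "p \<in> polys_in {..<length as}"
  shows "psubst (psubst p as) bs = psubst p (map (\<lambda>a. psubst a bs) as)"
  using subst_psubst[OF assms] by (simp add: psubst_eq_subst)

lemma polys_in_psubst:
  assumes "p \<in> polys_in {..<length as}" "set as \<subseteq> polys_in W"
  shows "psubst p as \<in> polys_in W"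
  unfolding psubst_eq_subst
  by (rule polys_in_subst[OF assms(1)]) (use assms(2) in \<open>auto dest: nth_mem\<close>)

lemma lessThan_2: "{..<2::nat} = {0, 1}"
  by auto

lemma psubst_id2: "p \<in> polys_in {0, 1} \<Longrightarrow> psubst p [Var 0, Var 1] = p"
  unfolding psubst_eq_subst by (rule subst_id) auto

lemma monomial2:
  assumes "Poly_Mapping.keys m \<subseteq> {0, 1::nat}"
  shows "m = Poly_Mapping.single 0 (Poly_Mapping.lookup m 0) + Poly_Mapping.single 1 (Poly_Mapping.lookup m 1 :: nat)"
proof (rule poly_mapping_eqI)
  fix k
  show "Poly_Mapping.lookup m k = Poly_Mapping.lookup (Poly_Mapping.single 0 (Poly_Mapping.lookup m 0)
      + Poly_Mapping.single 1 (Poly_Mapping.lookup m 1)) k"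
    using assms by (cases "k \<in> {0, 1}") (auto simp: lookup_add lookup_single when_def in_keys_iff)
qed

lemma subst_mon_pair:
  "subst_mon \<sigma> (Poly_Mapping.single a i + Poly_Mapping.single b j) = \<sigma> a ^ i * \<sigma> b ^ j"
  by (simp add: subst_mon_add)

lemma lookup_rename2:
  assumes p: "p \<in> polys_in {0, 1}" and ab: "a \<noteq> b"
  shows "Poly_Mapping.lookup (psubst p [Var a, Var b]) (Poly_Mapping.single a i + Poly_Mapping.single b j)
    = Poly_Mapping.lookup p (Poly_Mapping.single 0 i + Poly_Mapping.single 1 j)"
proof -
  let ?m = "Poly_Mapping.single 0 i + Poly_Mapping.single 1 j :: nat \<Rightarrow>\<^sub>0 nat"
  let ?n = "Poly_Mapping.single a i + Poly_Mapping.single b j :: nat \<Rightarrow>\<^sub>0 nat"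
  have "Poly_Mapping.lookup (subst_mon ((!) [Var a, Var b]) k) ?n = (if k = ?m then 1 else 0)"
    if "k \<in> Poly_Mapping.keys p" for k
  proof -
    define x y where "x = Poly_Mapping.lookup k 0" and "y = Poly_Mapping.lookup k 1"
    have k: "k = Poly_Mapping.single 0 x + Poly_Mapping.single 1 y"
      unfolding x_def y_def using p that by (intro monomial2) (auto simp: polys_in_def)
    have eq: "Poly_Mapping.single c x + Poly_Mapping.single d y = Poly_Mapping.single c i + Poly_Mapping.single d j
        \<longleftrightarrow> x = i \<and> y = j" if "c \<noteq> d" for c d :: nat
    proof
      assume h: "Poly_Mapping.single c x + Poly_Mapping.single d y = Poly_Mapping.single c i + Poly_Mapping.single d j"
      from arg_cong[OF h, of "\<lambda>m. Poly_Mapping.lookup m c"] arg_cong[OF h, of "\<lambda>m. Poly_Mapping.lookup m d"]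
      show "x = i \<and> y = j" using that by (simp add: lookup_add lookup_single)
    qed simp
    have "subst_mon ((!) [Var a, Var b]) k = subst_mon Var (Poly_Mapping.single a x + Poly_Mapping.single b y)"
      unfolding k subst_mon_pair by simp
    then show ?thesis
      using eq[OF ab] eq[of 0 1] by (auto simp: subst_mon_Var lookup_single k when_def)
  qed
  then have "Poly_Mapping.lookup (psubst p [Var a, Var b]) ?n =
      (\<Sum>k\<in>Poly_Mapping.keys p. if k = ?m then Poly_Mapping.lookup p k else 0)"
    unfolding psubst_eq_subst subst_def lookup_sum lookup_scl
    by (intro sum.cong) (auto simp del: One_nat_def)
  also have "\<dots> = Poly_Mapping.lookup p ?m"
    by (auto simp: sum.delta in_keys_iff)
  finally show ?thesis .
qed

declare One_nat_def [simp del]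


section \<open>Even period polynomials\<close>

lemma psubst_psubst2:
  assumes "p \<in> polys_in {0, 1}"
  shows "psubst (psubst p [a, b]) as = psubst p [psubst a as, psubst b as]"
  using assms psubst_map_psubst[of p "[a, b]" as] by (simp add: lessThan_2 flip: numeral_2_eq_2)

lemma polys_in_psubst2:
  assumes "p \<in> polys_in {0, 1}" "a \<in> polys_in W" "b \<in> polys_in W"
  shows "psubst p [a, b] \<in> polys_in W"
  using assms by (intro polys_in_psubst) (simp_all add: lessThan_2 flip: numeral_2_eq_2)

lemma subst_psubst2:
  assumes "p \<in> polys_in {0, 1}"
  shows "subst \<tau> (psubst p [a, b]) = psubst p [subst \<tau> a, subst \<tau> b]"
  using assms subst_psubst[of p "[a, b]" \<tau>] by (simp add: lessThan_2 flip: numeral_2_eq_2)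

text \<open>The conditions on a period polynomial on which the construction of \<open>f\<^sub>0\<close> and \<open>f\<^sub>1\<close> and their symmetries
  depend. They are linear and do not mention the degree, hence they hold on the whole of \<open>period_space\<close>,
  including its inhomogeneous elements.\<close>

definition even_alternating :: "mpol set" where
  "even_alternating = {f \<in> polys_in {0, 1}.
     psubst f [- Var 0, Var 1] = f \<and> psubst f [Var 0, - Var 1] = f \<and> psubst f [Var 1, Var 0] = - f \<and>
     Var 0 * Var 1 * (Var 0 - Var 1) dvd f}"

lemma dvd_scl: "d dvd p \<Longrightarrow> (d :: mpol) dvd scl c p"
  by (simp add: scl_eq_mult)

lemma subspace_even_alternating: "qvs.subspace even_alternating"
  unfolding qvs.subspace_def even_alternating_def
  by (auto simp: polys_in_add polys_in_scl dvd_scl)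

lemma Var_neq_0 [simp]: "Var i \<noteq> 0"
  by (metis Var_def lookup_single_eq lookup_zero zero_neq_one)

lemma Var_diff_neq_0: "i \<noteq> j \<Longrightarrow> Var i - Var j \<noteq> 0"
proof
  assume "i \<noteq> j" "Var i - Var j = 0"
  then have "Poly_Mapping.lookup (Var i - Var j) (Poly_Mapping.single i 1) = 0" by simp
  moreover have "Poly_Mapping.single j (1::nat) \<noteq> Poly_Mapping.single i 1"
    using \<open>i \<noteq> j\<close> by (metis keys_single singleton_inject zero_neq_one)
  ultimately show False by (simp add: Var_def lookup_minus lookup_single when_def)
qed

lemma f0_unique:
  assumes "f \<in> even_alternating"
  shows "\<exists>!h. h \<in> polys_in {0, 1} \<and> f = Var 0 * Var 1 * (Var 0 - Var 1) * h"
proof -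
  from assms obtain h where h: "f = Var 0 * Var 1 * (Var 0 - Var 1) * h" and f: "f \<in> polys_in {0, 1}"
    by (auto simp: even_alternating_def elim: dvdE)
  \<comment> \<open>A quotient by the product may a priori involve further variables; setting them to zero removes them.\<close>
  define \<rho> where "\<rho> = (\<lambda>i. if i \<in> {0, 1} then Var i else 0)"
  have "subst \<rho> f = f" using f by (rule subst_id) (auto simp: \<rho>_def)
  then have "f = Var 0 * Var 1 * (Var 0 - Var 1) * subst \<rho> h"
    by (subst (asm) h) (simp add: \<rho>_def)
  moreover have "subst \<rho> h \<in> polys_in {0, 1}"
    by (rule polys_in_subst[of h UNIV]) (simp_all add: \<rho>_def, simp add: polys_in_def)
  ultimately show ?thesis using Var_diff_neq_0[of 0 1]
    by (intro ex1I[of _ "subst \<rho> h"]) auto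
qed

lemma
  assumes "f \<in> even_alternating"
  shows f0_in: "f0 f \<in> polys_in {0, 1}"
    and f0_eq: "f = Var 0 * Var 1 * (Var 0 - Var 1) * f0 f"
  using theI'[OF f0_unique[OF assms]] unfolding f0_def by blast+

lemma f0_eqI:
  assumes "f \<in> even_alternating" "h \<in> polys_in {0, 1}" "f = Var 0 * Var 1 * (Var 0 - Var 1) * h"
  shows "f0 f = h"
  unfolding f0_def by (rule the1_equality[OF f0_unique[OF assms(1)]]) (use assms in auto)

lemma f0_add:
  assumes "f \<in> even_alternating" "g \<in> even_alternating"
  shows "f0 (f + g) = f0 f + f0 g"
proof (rule f0_eqI)
  show "f + g \<in> even_alternating" using assms subspace_even_alternating by (simp add: qvs.subspace_add)
  show "f0 f + f0 g \<in> polys_in {0, 1}" by (simp add: polys_in_add f0_in assms)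
  show "f + g = Var 0 * Var 1 * (Var 0 - Var 1) * (f0 f + f0 g)"
    unfolding distrib_left using f0_eq[OF assms(1)] f0_eq[OF assms(2)] by simp
qed

lemma f0_scl:
  assumes "f \<in> even_alternating"
  shows "f0 (scl c f) = scl c (f0 f)"
proof (rule f0_eqI)
  show "scl c f \<in> even_alternating" using assms subspace_even_alternating by (simp add: qvs.subspace_scale)
  show "scl c (f0 f) \<in> polys_in {0, 1}" by (simp add: polys_in_scl f0_in assms)
  show "scl c f = Var 0 * Var 1 * (Var 0 - Var 1) * scl c (f0 f)"
    unfolding scl_mult_right using f0_eq[OF assms] by simp
qed

lemma f1_in: "f \<in> even_alternating \<Longrightarrow> f1 f \<in> polys_in {0, 1}"
  by (auto simp: f1_def intro!: polys_in_mult polys_in_diff f0_in)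

lemma f1_eq: "f \<in> even_alternating \<Longrightarrow> f = Var 0 * Var 1 * f1 f"
  using f0_eq[of f] by (simp add: f1_def mult.assoc)

lemma psubst_f1: "psubst (f1 f) [x, y] = (x - y) * psubst (f0 f) [x, y]"
  by (simp add: f1_def)

text \<open>The point \<open>(X, Y)\<close> is generic: an identity proved there, where one may cancel \<open>X\<close>, \<open>Y\<close> and
  \<open>X - Y\<close>, specializes to every pair of polynomials, also to pairs at which these factors vanish.\<close>

lemma psubst2_eqI:
  assumes "p \<in> polys_in {0, 1}" "q \<in> polys_in {0, 1}"
    and "psubst p [a, b] = psubst q [c, d]"
  shows "psubst p [psubst a [x, y], psubst b [x, y]] = psubst q [psubst c [x, y], psubst d [x, y]]"
  using arg_cong[OF assms(3), of "\<lambda>r. psubst r [x, y]"] assms(1,2) by (simp add: psubst_psubst2)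

lemma mpol_eq_minus_iff: "(p :: mpol) = - p \<longleftrightarrow> p = 0"
proof
  assume "p = - p"
  then have "2 * p = 0" by (metis add.right_inverse mult_2)
  then show "p = 0" by simp
qed simp

context
  fixes f assumes f: "f \<in> even_alternating"
begin

lemma psubst_f1_minus_left: "psubst (f1 f) [- x, y] = - psubst (f1 f) [x, y]"
proof -
  have "psubst f [- Var 0, Var 1] = psubst f [Var 0, Var 1]"
    using f by (simp add: even_alternating_def psubst_id2)
  then have "Var 0 * Var 1 * psubst (f1 f) [- Var 0, Var 1] = Var 0 * Var 1 * - psubst (f1 f) [Var 0, Var 1]"
    by (subst (asm) (1 2) f1_eq[OF f]) (simp, metis minus_minus)
  then have "psubst (f1 f) [- Var 0, Var 1] = psubst (- f1 f) [Var 0, Var 1]"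
    unfolding psubst_uminus by (rule mult_left_cancel[THEN iffD1, rotated]) simp
  from psubst2_eqI[OF f1_in[OF f] polys_in_uminus[OF f1_in[OF f]] this, of x y] show ?thesis by simp
qed

lemma psubst_f1_swap: "psubst (f1 f) [y, x] = - psubst (f1 f) [x, y]"
proof -
  have "psubst f [Var 1, Var 0] = - psubst f [Var 0, Var 1]"
    using f by (simp add: even_alternating_def psubst_id2)
  then have "Var 0 * Var 1 * psubst (f1 f) [Var 1, Var 0] = Var 0 * Var 1 * - psubst (f1 f) [Var 0, Var 1]"
    by (subst (asm) (1 2) f1_eq[OF f]) (simp add: ac_simps)
  then have "psubst (f1 f) [Var 1, Var 0] = psubst (- f1 f) [Var 0, Var 1]"
    unfolding psubst_uminus by (rule mult_left_cancel[THEN iffD1, rotated]) simp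
  from psubst2_eqI[OF f1_in[OF f] polys_in_uminus[OF f1_in[OF f]] this, of x y] show ?thesis by simp
qed

lemma psubst_f1_minus_right: "psubst (f1 f) [x, - y] = - psubst (f1 f) [x, y]"
  by (metis psubst_f1_minus_left psubst_f1_swap)

lemma psubst_f1_0_right [simp]: "psubst (f1 f) [x, 0] = 0"
  using psubst_f1_minus_right[of x 0] by (simp add: mpol_eq_minus_iff)

lemma psubst_f1_0_left [simp]: "psubst (f1 f) [0, x] = 0"
  using psubst_f1_minus_left[of 0 x] by (simp add: mpol_eq_minus_iff)

lemma psubst_f0_0_right [simp]: "psubst (f0 f) [x, 0] = 0"
proof -
  have "Var 0 * psubst (f0 f) [Var 0, 0] = 0"
    using psubst_f1_0_right[of "Var 0"] unfolding psubst_f1 by simp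
  then have "psubst (f0 f) [Var 0, 0] = psubst 0 [Var 0, 0]" by simp
  from psubst2_eqI[OF f0_in[OF f] polys_in_0 this, of x 0] show ?thesis by simp
qed

lemma psubst_f0_0_left [simp]: "psubst (f0 f) [0, x] = 0"
proof -
  have "Var 0 * psubst (f0 f) [0, Var 0] = 0"
    using psubst_f1_0_left[of "Var 0"] unfolding psubst_f1 by simp
  then have "psubst (f0 f) [0, Var 0] = psubst 0 [0, Var 0]" by simp
  from psubst2_eqI[OF f0_in[OF f] polys_in_0 this, of x 0] show ?thesis by simp
qed

lemma psubst_f0_minus: "psubst (f0 f) [- x, - y] = - psubst (f0 f) [x, y]"
proof -
  have "psubst (f1 f) [- Var 0, - Var 1] = psubst (f1 f) [Var 0, Var 1]"
    by (simp only: psubst_f1_minus_left psubst_f1_minus_right minus_minus)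
  then have "(Var 0 - Var 1) * psubst (f0 f) [- Var 0, - Var 1]
      = (Var 0 - Var 1) * - psubst (f0 f) [Var 0, Var 1]"
    unfolding psubst_f1 by (simp add: algebra_simps)
  then have "psubst (f0 f) [- Var 0, - Var 1] = psubst (- f0 f) [Var 0, Var 1]"
    unfolding psubst_uminus
    by (rule mult_left_cancel[THEN iffD1, rotated]) (rule Var_diff_neq_0, simp)
  from psubst2_eqI[OF f0_in[OF f] polys_in_uminus[OF f0_in[OF f]] this, of x y] show ?thesis by simp
qed

end

lemma lookup_hcomp: "Poly_Mapping.lookup (hcomp d p) m = (if mdeg m = d then Poly_Mapping.lookup p m else 0)"
proof -
  have "Poly_Mapping.lookup (hcomp d p) m =
      (\<Sum>k\<in>{k \<in> Poly_Mapping.keys p. mdeg k = d}. if k = m then Poly_Mapping.lookup p m else 0)"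
    by (auto simp: hcomp_def lookup_sum lookup_single when_def intro!: sum.cong)
  then show ?thesis by (auto simp: sum.delta in_keys_iff)
qed

lemma hcomp_add: "hcomp d (p + q) = hcomp d p + hcomp d q"
  by (rule poly_mapping_eqI) (simp add: lookup_hcomp lookup_add)

lemma hcomp_scl: "hcomp d (scl c p) = scl c (hcomp d p)"
  by (rule poly_mapping_eqI) (simp add: lookup_hcomp)

lemma hcomp_homogeneous: "homogeneous e p \<Longrightarrow> hcomp d p = (if d = e then p else 0)"
  by (rule poly_mapping_eqI) (auto simp: lookup_hcomp homogeneous_def in_keys_iff)

lemma sum_hcomp: "(\<Sum>d\<in>mdeg ` Poly_Mapping.keys p. hcomp d p) = p"
  by (rule poly_mapping_eqI) (auto simp: lookup_sum lookup_hcomp sum.delta in_keys_iff image_iff)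

lemma homogeneous_add: "homogeneous d p \<Longrightarrow> homogeneous d q \<Longrightarrow> homogeneous d (p + q)"
  using keys_add[of p q] by (auto simp: homogeneous_def)

lemma homogeneous_scl: "homogeneous d p \<Longrightarrow> homogeneous d (scl c p)"
  by (auto simp: homogeneous_def in_keys_iff)

lemma
  assumes "f \<in> period_hom n"
  shows period_hom_in: "f \<in> polys_in {0, 1}"
    and period_hom_homogeneous: "homogeneous (2 * n - 2) f"
    and period_hom_swap: "psubst f [Var 1, Var 0] = - f"
    and period_hom_minus_left: "psubst f [- Var 0, Var 1] = f"
    and period_hom_minus_right: "psubst f [Var 0, - Var 1] = f"
    and period_hom_three_term:
      "psubst f [Var 0, Var 1] + psubst f [Var 0 - Var 1, Var 0] + psubst f [- Var 1, Var 0 - Var 1] = 0"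
    and period_hom_cusp: "psubst f [1, 0] = 0"
  using assms
  by (auto simp: period_hom_def Let_def psubst_id2 add_eq_0_iff)

lemma period_hom_add: "f \<in> period_hom n \<Longrightarrow> g \<in> period_hom n \<Longrightarrow> f + g \<in> period_hom n"
  using period_hom_three_term[of f n] period_hom_three_term[of g n]
  by (auto simp: period_hom_def Let_def polys_in_add homogeneous_add add_eq_0_iff algebra_simps)

lemma period_hom_scl: "f \<in> period_hom n \<Longrightarrow> scl c f \<in> period_hom n"
  by (auto simp: period_hom_def Let_def polys_in_scl homogeneous_scl simp flip: qvs.scale_right_distrib)

lemma period_hom_0: "0 \<in> period_hom n"
  by (auto simp: period_hom_def Let_def homogeneous_def)

text \<open>By homogeneity \<open>f(x, 0) = x\<^sup>d f(1, 0)\<close>, so the vanishing at the cusp excludes pure powers. Together with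
  evenness this makes all exponents that occur in \<open>f\<close> even and positive.\<close>

lemma psubst_axis_left_0:
  assumes f: "f \<in> period_hom n" shows "psubst f [x, 0] = 0"
proof -
  have "psubst f [x, 0] = subst (\<lambda>i. x * [1, 0] ! i) f"
    unfolding psubst_eq_subst using period_hom_in[OF f] by (rule subst_cong) auto
  also have "\<dots> = x ^ (2 * n - 2) * psubst f [1, 0]"
    by (simp add: homogeneous_subst_scale[OF period_hom_homogeneous[OF f]] psubst_eq_subst)
  finally show ?thesis by (simp add: period_hom_cusp[OF f])
qed

lemma psubst_axis_right_0:
  assumes f: "f \<in> period_hom n" shows "psubst f [0, x] = 0"
  using arg_cong[OF period_hom_swap[OF f], of "\<lambda>p. psubst p [0, x]"]
  by (simp add: psubst_psubst2 period_hom_in[OF f] psubst_axis_left_0[OF f])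

lemma period_hom_exponents:
  assumes f: "f \<in> period_hom n" and m: "Poly_Mapping.lookup f m \<noteq> 0"
  shows "even (Poly_Mapping.lookup m 0)" "even (Poly_Mapping.lookup m 1)"
    "Poly_Mapping.lookup m 0 \<noteq> 0" "Poly_Mapping.lookup m 1 \<noteq> 0"
proof -
  note fin = period_hom_in[OF f]
  have keys: "Poly_Mapping.keys m \<subseteq> {0, 1}"
    using fin m by (auto simp: polys_in_def in_keys_iff)
  have "subst (flip 0) f = psubst f [- Var 0, Var 1]"
    unfolding psubst_eq_subst by (rule subst_cong[OF fin]) auto
  then have "subst (flip 0) f = f"
    by (simp add: period_hom_minus_left[OF f])
  then show "even (Poly_Mapping.lookup m 0)"
    using m lookup_eq_0_if_flip_invariant by blast
  have "subst (flip 1) f = psubst f [Var 0, - Var 1]"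
    unfolding psubst_eq_subst by (rule subst_cong[OF fin]) auto
  then have "subst (flip 1) f = f"
    by (simp add: period_hom_minus_right[OF f])
  then show "even (Poly_Mapping.lookup m 1)"
    using m lookup_eq_0_if_flip_invariant by blast
  show "Poly_Mapping.lookup m 0 \<noteq> 0"
  proof
    assume "Poly_Mapping.lookup m 0 = 0"
    then have "0 \<notin> Poly_Mapping.keys m" by (simp add: in_keys_iff)
    then have "Poly_Mapping.keys m \<subseteq> {1}" using keys by auto
    moreover have "subst (\<lambda>i. if i \<in> {1} then Var i else 0) f = psubst f [0, Var 1]"
      unfolding psubst_eq_subst by (rule subst_cong[OF fin]) auto
    ultimately show False
      using m lookup_restrict[of m "{1}" f] by (simp add: psubst_axis_right_0[OF f])
  qed
  show "Poly_Mapping.lookup m 1 \<noteq> 0"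
  proof
    assume "Poly_Mapping.lookup m 1 = 0"
    then have "1 \<notin> Poly_Mapping.keys m" by (simp add: in_keys_iff)
    then have "Poly_Mapping.keys m \<subseteq> {0}" using keys by auto
    moreover have "subst (\<lambda>i. if i \<in> {0} then Var i else 0) f = psubst f [Var 0, 0]"
      unfolding psubst_eq_subst by (rule subst_cong[OF fin]) auto
    ultimately show False
      using m lookup_restrict[of m "{0}" f] by (simp add: psubst_axis_left_0[OF f])
  qed
qed

lemma diff_dvd_power_diff: "x - y dvd x ^ k - (y :: 'a :: comm_ring_1) ^ k"
proof (induction k)
  case (Suc k)
  have "x ^ Suc k - y ^ Suc k = x * (x ^ k - y ^ k) + (x - y) * y ^ k"
    by (simp add: algebra_simps)
  then show ?case using Suc by simp
qed simp

lemma diff_dvd_alternating_monomial: "x - y dvd x ^ a * y ^ b - y ^ a * (x :: 'a :: comm_ring_1) ^ b"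
proof -
  have "x ^ a * y ^ b - y ^ a * x ^ b = y ^ b * (x ^ a - y ^ a) - y ^ a * (x ^ b - y ^ b)"
    by (simp add: algebra_simps)
  then show ?thesis by (simp add: diff_dvd_power_diff)
qed

text \<open>An alternating \<open>f\<close> is half the sum of the terms \<open>c (X\<^sup>i Y\<^sup>j - X\<^sup>j Y\<^sup>i)\<close>, and the exponents are
  positive.\<close>

lemma dvd_period_hom:
  assumes f: "f \<in> period_hom n"
  shows "Var 0 * Var 1 * (Var 0 - Var 1) dvd f"
proof -
  let ?d = "\<lambda>m. subst_mon ((!) [Var 0, Var 1]) m - subst_mon ((!) [Var 1, Var 0]) m"
  have "Var 0 * Var 1 * (Var 0 - Var 1) dvd ?d m" if "m \<in> Poly_Mapping.keys f" for m
  proof -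
    define a b where "a = Poly_Mapping.lookup m 0 - 1" and "b = Poly_Mapping.lookup m 1 - 1"
    have "Poly_Mapping.keys m \<subseteq> {0, 1}"
      using period_hom_in[OF f] that by (auto simp: polys_in_def)
    then have m: "m = Poly_Mapping.single 0 (Suc a) + Poly_Mapping.single 1 (Suc b)"
      using monomial2[of m] period_hom_exponents(3,4)[OF f, of m] that by (simp add: a_def b_def in_keys_iff)
    have "?d m = Var 0 * Var 1 * (Var 0 ^ a * Var 1 ^ b - Var 1 ^ a * Var 0 ^ b)"
      unfolding m subst_mon_pair by (simp add: algebra_simps)
    then show ?thesis
      by (simp add: diff_dvd_alternating_monomial mult_dvd_mono)
  qed
  then have "Var 0 * Var 1 * (Var 0 - Var 1) dvd
      scl (1/2) (\<Sum>m\<in>Poly_Mapping.keys f. scl (Poly_Mapping.lookup f m) (?d m))"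
    by (intro dvd_scl dvd_sum)
  also have "(\<Sum>m\<in>Poly_Mapping.keys f. scl (Poly_Mapping.lookup f m) (?d m)) =
      psubst f [Var 0, Var 1] - psubst f [Var 1, Var 0]"
    by (simp add: psubst_eq_subst subst_def qvs.scale_right_diff_distrib sum_subtractf)
  also have "\<dots> = f + f"
    using f by (simp only: period_hom_swap psubst_id2 period_hom_in diff_minus_eq_add)
  also have "scl (1/2) \<dots> = f"
    by (rule poly_mapping_eqI) (simp only: lookup_scl lookup_add field_sum_of_halves distrib_left)
  finally show ?thesis .
qed

lemma period_hom_subset_even_alternating: "period_hom n \<subseteq> even_alternating"
  by (auto simp: even_alternating_def period_hom_in period_hom_minus_left period_hom_minus_right
      period_hom_swap dvd_period_hom)

lemma period_space_subset_even_alternating: "period_space \<subseteq> even_alternating"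
  unfolding period_space_def using period_hom_subset_even_alternating
  by (intro qvs.span_minimal subspace_even_alternating) blast

lemma subspace_period_space: "qvs.subspace period_space"
  by (simp add: period_space_def)

text \<open>For even \<open>d\<close> the index is the \<open>n\<close> with \<open>2 n - 2 = d\<close>; for odd \<open>d\<close> the component is zero, which lies
  in every \<open>period_hom n\<close>.\<close>

lemma hcomp_period_space:
  assumes "f \<in> period_space" shows "hcomp d f \<in> period_hom (d div 2 + 1)"
  using assms unfolding period_space_def
proof (induction rule: qvs.span_induct_alt)
  case base
  show ?case using period_hom_0 by (simp add: hcomp_def)
next
  case (step c g f)
  then obtain n where n: "n \<ge> 1" "g \<in> period_hom n" by auto
  have "hcomp d g = (if d = 2 * n - 2 then g else 0)"
    by (rule hcomp_homogeneous[OF period_hom_homogeneous[OF n(2)]])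
  moreover have "(2 * n - 2) div 2 + 1 = n" using n(1) by simp
  ultimately have "hcomp d g \<in> period_hom (d div 2 + 1)"
    using n(2) period_hom_0 by auto
  then show ?case
    using step.IH by (simp add: hcomp_add hcomp_scl period_hom_add period_hom_scl)
qed

lemma keys_pair: "Poly_Mapping.keys (Poly_Mapping.single a i + Poly_Mapping.single b j) \<subseteq> {a, b}"
  using keys_add[of "Poly_Mapping.single a i" "Poly_Mapping.single b j"] by (auto split: if_splits)

lemma mdeg_pair: "a \<noteq> b \<Longrightarrow> mdeg (Poly_Mapping.single a i + Poly_Mapping.single b j) = i + j"
proof -
  assume ab: "a \<noteq> b"
  have *: "mdeg m = (\<Sum>k\<in>A. Poly_Mapping.lookup m k)" if "finite A" "Poly_Mapping.keys m \<subseteq> A" for A m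
    unfolding mdeg_def by (rule sum.mono_neutral_left) (use that in \<open>auto simp: in_keys_iff\<close>)
  have "Poly_Mapping.keys (Poly_Mapping.single a i + Poly_Mapping.single b j) \<subseteq> {a, b}"
    using keys_add[of "Poly_Mapping.single a i" "Poly_Mapping.single b j"] by (auto split: if_splits)
  from *[OF _ this] show ?thesis using ab by (simp add: lookup_add lookup_single)
qed

lemma power_comparison: "n \<ge> 3 \<Longrightarrow> 8 * 2 ^ n < 3 * (3 :: int) ^ n"
proof (induction n rule: nat_induct_at_least)
  case (Suc n)
  have "(0 :: int) < 3 ^ n" by simp
  then show ?case using Suc.IH unfolding power_Suc by linarith
qed simp

text \<open>If no monomial has both exponents at least \<open>4\<close>, then one exponent is \<open>2\<close> and antisymmetry leaves
  \<open>f = c (X\<^sup>D Y\<^sup>2 - X\<^sup>2 Y\<^sup>D)\<close>. The three-term relation at \<open>(3, 1)\<close> reads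
  \<open>c (8 \<cdot> 2\<^sup>D - 3 \<cdot> 3\<^sup>D - 5) = 0\<close>. As \<open>D \<ge> 2\<close>, the second factor is negative unless \<open>D = 2\<close>, and for
  \<open>D = 2\<close> the polynomial \<open>f\<close> is zero by its form.\<close>

lemma period_hom_eq_0I:
  assumes f: "f \<in> period_hom n"
    and inner: "\<And>i j. even i \<Longrightarrow> even j \<Longrightarrow> i \<ge> 4 \<Longrightarrow> j \<ge> 4 \<Longrightarrow>
      Poly_Mapping.lookup f (Poly_Mapping.single 0 i + Poly_Mapping.single 1 j) = 0"
  shows "f = 0"
proof -
  \<comment> \<open>the exponent that accompanies the exponent \<open>2\<close> in degree \<open>2 n - 2\<close>\<close>
  define D where "D = 2 * n - 4"
  let ?mon = "\<lambda>i j. Poly_Mapping.single 0 i + Poly_Mapping.single 1 j :: nat \<Rightarrow>\<^sub>0 nat"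
  define c where "c = Poly_Mapping.lookup f (?mon D 2)"
  have anti: "Poly_Mapping.lookup f (?mon i j) = - Poly_Mapping.lookup f (?mon j i)" for i j
    using lookup_rename2[OF period_hom_in[OF f], of 1 0 j i] period_hom_swap[OF f]
    by (simp add: add.commute)
  have supp: "\<exists>D\<ge>2. n = D div 2 + 2 \<and> even D \<and> (m = ?mon D 2 \<or> m = ?mon 2 D)" if "Poly_Mapping.lookup f m \<noteq> 0" for m
  proof -
    define i j where "i = Poly_Mapping.lookup m 0" and "j = Poly_Mapping.lookup m 1"
    have "Poly_Mapping.keys m \<subseteq> {0, 1}"
      using period_hom_in[OF f] that by (auto simp: polys_in_def in_keys_iff)
    then have m: "m = ?mon i j" unfolding i_def j_def by (rule monomial2)
    have ij: "even i" "even j" "i \<noteq> 0" "j \<noteq> 0"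
      using period_hom_exponents[OF f that] by (simp_all add: i_def j_def)
    have deg: "i + j = 2 * n - 2"
      using period_hom_homogeneous[OF f] that m mdeg_pair[of 0 1 i j]
      by (auto simp: homogeneous_def in_keys_iff)
    have "i < 4 \<or> j < 4" using inner[of i j] that m ij by force
    moreover have "i = 2" if "i < 4" using that ij by (auto elim!: evenE)
    moreover have "j = 2" if "j < 4" using that ij by (auto elim!: evenE)
    ultimately consider "i = 2" | "j = 2" by blast
    then show ?thesis
    proof cases
      case 1
      then show ?thesis using deg ij m by (intro exI[of _ j]) (auto elim!: evenE)
    next
      case 2
      then show ?thesis using deg ij m by (intro exI[of _ i]) (auto elim!: evenE)
    qed
  qed
  show ?thesis
  proof (rule ccontr)
    assume "f \<noteq> 0"
    then obtain m where "Poly_Mapping.lookup f m \<noteq> 0" by (metis poly_mapping_eqI lookup_zero)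
    from supp[OF this] have D: "D \<ge> 2" "even D" and n: "n = D div 2 + 2"
      by (auto simp: D_def elim!: evenE)
    have supp': "m = ?mon D 2 \<or> m = ?mon 2 D" if "Poly_Mapping.lookup f m \<noteq> 0" for m
      using supp[OF that] by (auto simp: D_def elim!: evenE)
    have f_eq: "f = Poly_Mapping.single (?mon D 2) c - Poly_Mapping.single (?mon 2 D) c"
    proof (rule poly_mapping_eqI)
      fix m
      show "Poly_Mapping.lookup f m =
          Poly_Mapping.lookup (Poly_Mapping.single (?mon D 2) c - Poly_Mapping.single (?mon 2 D) c) m"
        using supp'[of m] anti[of D 2] by (cases "Poly_Mapping.lookup f m = 0")
          (auto simp: lookup_minus lookup_single when_def c_def)
    qed
    have val: "psubst f [x, y] = scl c (x ^ D * y ^ 2 - x ^ 2 * y ^ D)" for x y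
      by (simp add: f_eq psubst_eq_subst subst_mon_pair qvs.scale_right_diff_distrib
          del: single_numeral)
    have "psubst f [3, 1] + psubst f [2, 3] + psubst f [- 1, 2] = 0"
      using arg_cong[OF period_hom_three_term[OF f], of "\<lambda>p. psubst p [3, 1]"]
      by (simp add: psubst_psubst2 period_hom_in[OF f])
    then have "scl c (of_int (8 * 2 ^ D - 3 * 3 ^ D - 5) :: mpol) = 0"
      using \<open>even D\<close> by (simp add: val flip: qvs.scale_right_distrib)
    moreover have "c \<noteq> 0"
      using \<open>f \<noteq> 0\<close> f_eq by auto
    ultimately have "(8 * 2 ^ D - 3 * 3 ^ D - 5 :: int) = 0"
      by (metis of_int_eq_0_iff qvs.scale_eq_0_iff)
    moreover have "8 * 2 ^ D - 3 * 3 ^ D < (0 :: int)" if "D \<ge> 3"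
      using power_comparison[OF that] by simp
    ultimately have "D = 2" using D by (cases "D \<ge> 3") auto
    then show False using \<open>f \<noteq> 0\<close> f_eq by simp
  qed
qed

lemma lookup_shift: "Poly_Mapping.lookup (Poly_Mapping.single a 1 * (p :: mpol)) (a + b) = Poly_Mapping.lookup p b"
proof (induction p rule: poly_mapping_sum_induct)
  case (single k c)
  then show ?case by (auto simp: mult_single lookup_single when_def)
qed (simp add: distrib_left lookup_add)

lemma lookup_f1:
  assumes "f \<in> even_alternating"
  shows "Poly_Mapping.lookup (f1 f) (Poly_Mapping.single 0 i + Poly_Mapping.single 1 j)
    = Poly_Mapping.lookup f (Poly_Mapping.single 0 (Suc i) + Poly_Mapping.single 1 (Suc j))"
proof -
  let ?a = "Poly_Mapping.single 0 1 + Poly_Mapping.single 1 1 :: nat \<Rightarrow>\<^sub>0 nat"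
  have "f = Poly_Mapping.single ?a 1 * f1 f"
    using f1_eq[OF assms] by (simp add: Var_def mult_single)
  moreover have "Poly_Mapping.single 0 (Suc i) + Poly_Mapping.single 1 (Suc j)
      = ?a + (Poly_Mapping.single 0 i + Poly_Mapping.single 1 j)"
    by (rule poly_mapping_eqI) (auto simp: lookup_add lookup_single when_def simp del: single_one)
  ultimately show ?thesis by (metis lookup_shift)
qed

lemma period_space_eq_0I:
  assumes f: "f \<in> period_space"
    and inner: "\<And>i j. odd i \<Longrightarrow> odd j \<Longrightarrow> i \<ge> 3 \<Longrightarrow> j \<ge> 3 \<Longrightarrow>
      Poly_Mapping.lookup (f1 f) (Poly_Mapping.single 0 i + Poly_Mapping.single 1 j) = 0"
  shows "f = 0"
proof -
  have "hcomp d f = 0" for d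
  proof (rule period_hom_eq_0I[OF hcomp_period_space[OF f]])
    fix i j :: nat assume "even i" "even j" "i \<ge> 4" "j \<ge> 4"
    then have "Poly_Mapping.lookup f (Poly_Mapping.single 0 i + Poly_Mapping.single 1 j) = 0"
      using inner[of "i - 1" "j - 1"] lookup_f1[of f "i - 1" "j - 1"] f period_space_subset_even_alternating
      by auto
    then show "Poly_Mapping.lookup (hcomp d f) (Poly_Mapping.single 0 i + Poly_Mapping.single 1 j) = 0"
      by (simp add: lookup_hcomp)
  qed
  then show ?thesis using sum_hcomp[of f] by simp
qed

section \<open>The exceptional elements\<close>

lemma e_hom_add:
  assumes "f \<in> even_alternating" "g \<in> even_alternating"
  shows "e_hom (f + g) = e_hom f + e_hom g"
proof -
  have "f1 (f + g) = f1 f + f1 g"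
    by (simp add: f1_def f0_add assms distrib_left)
  then show ?thesis
    unfolding e_hom_def Let_def sum.distrib[symmetric]
    by (intro sum.cong refl) (simp add: f0_add assms distrib_left add_ac)
qed

lemma e_hom_scl:
  assumes "f \<in> even_alternating"
  shows "e_hom (scl c f) = scl c (e_hom f)"
proof -
  have "f1 (scl c f) = scl c (f1 f)"
    by (simp add: f1_def f0_scl assms scl_mult_right)
  then show ?thesis
    unfolding e_hom_def Let_def qvs.scale_sum_right
    by (intro sum.cong refl) (simp add: f0_scl assms scl_mult_right qvs.scale_right_distrib)
qed

lemma hcomp_even_alternating: "f \<in> period_space \<Longrightarrow> hcomp d f \<in> even_alternating"
  using hcomp_period_space period_hom_subset_even_alternating by blast

lemma e_hom_sum:
  assumes "\<And>d. h d \<in> even_alternating"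
  shows "e_hom (\<Sum>d\<in>A. h d) = (\<Sum>d\<in>A. e_hom (h d))"
proof (induction A rule: infinite_finite_induct)
  case (insert x A)
  have "(\<Sum>d\<in>A. h d) \<in> even_alternating"
    using assms subspace_even_alternating by (simp add: qvs.subspace_sum)
  then show ?case using insert assms by (simp add: e_hom_add)
qed (use e_hom_scl[of 0 0] qvs.subspace_0[OF subspace_even_alternating] in simp_all)

text \<open>The linear extension of \<open>e_hom\<close> is \<open>e_hom\<close> itself, because division by \<open>X Y (X - Y)\<close> is linear.\<close>

lemma e_poly_eq: "f \<in> period_space \<Longrightarrow> e_poly f = e_hom f"
  using e_hom_sum[of "\<lambda>d. hcomp d f" "mdeg ` Poly_Mapping.keys f"]
  by (simp add: e_poly_def extend_hom_def hcomp_even_alternating sum_hcomp)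

lemma lessThan_5: "{..<5::nat} = {0, 1, 2, 3, 4}"
  by auto

lemma e_hom_in:
  assumes "f \<in> even_alternating" shows "e_hom f \<in> polys_in {..<5}"
  unfolding e_hom_def Let_def
  by (intro polys_in_sum polys_in_add polys_in_mult polys_in_psubst2 f0_in[OF assms] f1_in[OF assms])
    (auto simp: polys_in_diff)

definition e_at :: "mpol \<Rightarrow> mpol \<Rightarrow> mpol \<Rightarrow> mpol \<Rightarrow> mpol \<Rightarrow> mpol \<Rightarrow> mpol" where
  "e_at f a b c d e = psubst (e_hom f) [a, b, c, d, e]"

context
  fixes f assumes f: "f \<in> even_alternating"
begin

lemma e_at_eq:
  "e_at f a b c d e =
     psubst (f1 f) [e - d, c - b] + (a - b) * psubst (f0 f) [c - d, e - d] +
     (psubst (f1 f) [a - e, d - c] + (b - c) * psubst (f0 f) [d - e, a - e]) +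
     (psubst (f1 f) [b - a, e - d] + (c - d) * psubst (f0 f) [e - a, b - a]) +
     (psubst (f1 f) [c - b, a - e] + (d - e) * psubst (f0 f) [a - b, c - b]) +
     (psubst (f1 f) [d - c, b - a] + (e - a) * psubst (f0 f) [b - c, d - c])"
  using f0_in[OF f] f1_in[OF f]
  by (simp add: e_at_def e_hom_def Let_def lessThan_5 psubst_psubst2)

lemma e_at_rotate: "e_at f a b c d e = e_at f b c d e a"
  by (simp add: e_at_eq ac_simps)

lemma e_at_one: "e_at f a 0 0 0 0 = 0"
  by (simp add: e_at_eq f)

lemma e_at_two: "e_at f a b 0 0 0 = psubst (f1 f) [a, b]"
  by (simp add: e_at_eq f psubst_f1_swap[OF f, of "- b"] psubst_f1_minus_right[OF f])

end

context
  fixes f assumes f: "f \<in> even_alternating"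
begin

lemma e_at_minus: "e_at f (- a) (- b) (- c) (- d) (- e) = e_at f a b c d e"
  by (simp only: e_at_eq[OF f] minus_diff_minus psubst_f1_minus_left[OF f] psubst_f1_minus_right[OF f]
      psubst_f0_minus[OF f] minus_minus minus_mult_minus)

text \<open>Consequently the sign in the definition of the bracket is \<open>+1\<close> on every homogeneous component.\<close>

lemma e_hom_even_degree:
  assumes "m \<in> Poly_Mapping.keys (e_hom f)" shows "even (mdeg m)"
proof -
  have eq: "e_at f (\<sigma> 0) (\<sigma> 1) (\<sigma> 2) (\<sigma> 3) (\<sigma> 4) = subst \<sigma> (e_hom f)" for \<sigma>
    unfolding e_at_def psubst_eq_subst by (rule subst_cong[OF e_hom_in[OF f]]) (auto simp: lessThan_5)
  have "subst (\<lambda>i. - Var i) (e_hom f) = subst Var (e_hom f)"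
    unfolding eq[symmetric] by (rule e_at_minus)
  then show ?thesis
    using lookup_negate[of "e_hom f" m] assms by (cases "even (mdeg m)") (auto simp: in_keys_iff)
qed

end

section \<open>The bracket of two exceptional elements\<close>

lemma circ_hom_add_left: "circ_hom r s d (p + p') q = circ_hom r s d p q + circ_hom r s d p' q"
  by (simp add: circ_hom_def distrib_right distrib_left sum.distrib ac_simps)

lemma circ_hom_scl_left: "circ_hom r s d (scl c p) q = scl c (circ_hom r s d p q)"
  by (simp add: circ_hom_def scl_mult_left scl_mult_right qvs.scale_right_distrib flip: qvs.scale_sum_right)

lemma circ_hom_add_right: "circ_hom r s d p (q + q') = circ_hom r s d p q + circ_hom r s d p q'"
  by (simp add: circ_hom_def distrib_right distrib_left sum.distrib ac_simps)

lemma circ_hom_scl_right: "circ_hom r s d p (scl c q) = scl c (circ_hom r s d p q)"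
  by (simp add: circ_hom_def scl_mult_left scl_mult_right qvs.scale_right_distrib flip: qvs.scale_sum_right)

lemma circ_hom_0_left: "circ_hom r s d 0 q = 0"
  by (simp add: circ_hom_def)

lemma circ_hom_sum_left: "circ_hom r s d (sum h A) q = (\<Sum>x\<in>A. circ_hom r s d (h x) q)"
  by (induction A rule: infinite_finite_induct) (simp_all add: circ_hom_0_left circ_hom_add_left)

lemma circ_even:
  assumes "\<And>m. m \<in> Poly_Mapping.keys p \<Longrightarrow> even (mdeg m)"
  shows "circ r s p q = circ_hom r s 0 p q"
proof -
  have "circ r s p q = (\<Sum>d\<in>mdeg ` Poly_Mapping.keys p. circ_hom r s 0 (hcomp d p) q)"
    unfolding circ_def extend_hom_def
    using assms by (intro sum.cong refl) (auto simp: circ_hom_def power_add)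
  also have "\<dots> = circ_hom r s 0 (\<Sum>d\<in>mdeg ` Poly_Mapping.keys p. hcomp d p) q"
    by (rule circ_hom_sum_left[symmetric])
  finally show ?thesis by (simp add: sum_hcomp)
qed

definition e_circ :: "mpol \<Rightarrow> mpol \<Rightarrow> mpol" where
  "e_circ f g = circ_hom 4 4 0 (e_hom f) (e_hom g)"

lemma e_bracket_eq:
  assumes "f \<in> period_space" "g \<in> period_space"
  shows "e_bracket f g = psubst (e_circ f g - e_circ g f) (0 # map Var [1..<9])"
proof -
  have "circ 4 4 (e_hom f) (e_hom g) = e_circ f g" if "f \<in> period_space" for f g
    unfolding e_circ_def using that period_space_subset_even_alternating
    by (intro circ_even) (auto dest: e_hom_even_degree)
  then show ?thesis
    using assms by (simp add: e_bracket_def ihara_bracket_def reduced_def e_poly_eq)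
qed

lemma e_circ_in:
  assumes "f \<in> even_alternating" "g \<in> even_alternating"
  shows "e_circ f g \<in> polys_in {..<9}"
  unfolding e_circ_def circ_hom_def
  by (simp, intro polys_in_add polys_in_mult polys_in_sum polys_in_psubst)
    (use assms[THEN e_hom_in] in auto)

lemma psubst_e_at:
  assumes "f \<in> even_alternating"
  shows "psubst (e_at f a b c d e) as =
    e_at f (psubst a as) (psubst b as) (psubst c as) (psubst d as) (psubst e as)"
proof -
  have "length [a, b, c, d, e] = 5" by simp
  then have "e_hom f \<in> polys_in {..<length [a, b, c, d, e]}"
    by (simp only: e_hom_in[OF assms])
  then show ?thesis
    unfolding e_at_def by (subst psubst_map_psubst) simp_all
qed

text \<open>The zeros are placed so that four of the nine products have the factor \<open>e\<^sub>g(0, d, 0, 0, 0)\<close> or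
  \<open>e\<^sub>g(0, a, 0, 0, 0)\<close> and vanish. The two reversed products that remain have the factor
  \<open>f\<^sub>1(d, c) = - f\<^sub>1(c, d)\<close>; one of them cancels against the product with \<open>e\<^sub>f(0, c, d, 0, 0)\<close>.\<close>

lemma psubst_e_circ:
  assumes f: "f \<in> even_alternating" and g: "g \<in> even_alternating"
  shows "psubst (e_circ f g) [0, a, b, 0, c, d, 0, 0, 0] =
     e_at f c d 0 b 0 * psubst (f1 g) [a, b] + psubst (f1 f) [c, d] * e_at g a b 0 c 0
     - psubst (f1 f) [c, d] * psubst (f1 g) [a, b]"
proof -
  have [simp]: "{0..4::nat} = {0, 1, 2, 3, 4}" "{1..4::nat} = {1, 2, 3, 4}"
    by auto
  have rot: "e_at h 0 x 0 0 0 = 0" "e_at h 0 x y 0 0 = psubst (f1 h) [x, y]"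
    "e_at h 0 0 x y 0 = psubst (f1 h) [x, y]" "e_at h 0 0 0 x y = psubst (f1 h) [x, y]"
    "e_at h x 0 y z 0 = e_at h y z 0 x 0" "e_at h 0 x y 0 z = e_at h x y 0 z 0"
    if "h \<in> even_alternating" for h x y z
    using e_at_one[OF that, of x] e_at_two[OF that, of x y] e_at_rotate[OF that, of 0 x 0 0 0]
      e_at_rotate[OF that, of 0 x y 0 0] e_at_rotate[OF that, of 0 0 x y 0] e_at_rotate[OF that, of 0 0 0 x y]
      e_at_rotate[OF that, of x 0 y z 0] e_at_rotate[OF that, of 0 y z 0 x] e_at_rotate[OF that, of 0 x y 0 z]
    by (simp_all only:)
  have "psubst (e_circ f g) [0, a, b, 0, c, d, 0, 0, 0] =
      e_at f 0 a b 0 c * e_at g 0 d 0 0 0 + e_at f a b 0 c d * e_at g 0 a 0 0 0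
      + e_at f b 0 c d 0 * e_at g 0 a b 0 0 + e_at f 0 c d 0 0 * e_at g 0 a b 0 0
      + e_at f c d 0 0 0 * e_at g 0 a b 0 c
      + e_at f d c 0 b a * e_at g 0 d 0 0 0 + e_at f 0 d c 0 b * e_at g 0 a 0 0 0
      + e_at f 0 0 d c 0 * e_at g 0 a b 0 0 + e_at f 0 0 0 d c * e_at g 0 a b 0 0"
    using psubst_e_at[OF f] psubst_e_at[OF g]
    by (simp add: e_circ_def circ_hom_def upt_rec flip: e_at_def)
  also have "\<dots> = e_at f c d 0 b 0 * psubst (f1 g) [a, b] + psubst (f1 f) [c, d] * psubst (f1 g) [a, b]
      + psubst (f1 f) [c, d] * e_at g a b 0 c 0
      + psubst (f1 f) [d, c] * psubst (f1 g) [a, b] + psubst (f1 f) [d, c] * psubst (f1 g) [a, b]"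
    by (simp only: rot[OF f] rot[OF g] e_at_two[OF f] e_at_two[OF g] psubst_f1_0_left[OF g] mult_zero_right add_0 add_0_right)
  also have "psubst (f1 f) [d, c] = - psubst (f1 f) [c, d]"
    by (rule psubst_f1_swap[OF f])
  finally show ?thesis by simp
qed

text \<open>The shared variable \<open>r\<close> occurs with odd exponents in the second factor, which is why terms of the
  first factor that are odd in \<open>r\<close> do not contribute. The others are excluded by their degree in \<open>p\<close> or \<open>q\<close>.\<close>

lemma lookup_e_at_mult_f1:
  assumes f: "f \<in> even_alternating" and g: "g \<in> even_alternating"
    and dist: "distinct [p, q, r, s]"
    and m: "Poly_Mapping.lookup m p \<ge> 2" "Poly_Mapping.lookup m q \<ge> 2" "odd (Poly_Mapping.lookup m r)"
  shows "Poly_Mapping.lookup (e_at f (Var p) (Var q) 0 (Var r) 0 * psubst (f1 g) [Var r, Var s]) m =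
    Poly_Mapping.lookup (psubst (f1 f) [Var p, Var q] * psubst (f1 g) [Var r, Var s]) m"
proof -
  let ?F0 = "\<lambda>x y. psubst (f0 f) [x, y]" and ?F1 = "\<lambda>x y. psubst (f1 f) [x, y]"
  let ?H = "psubst (f1 g) [Var r, Var s]"
  let ?a = "Var p" and ?b = "Var q" and ?c = "Var r"
  have H_in: "?H \<in> polys_in (- {p})" "?H \<in> polys_in (- {q})"
    using dist by (auto intro!: polys_in_psubst2 f1_in g)
  have free: "Poly_Mapping.lookup (h * ?H) m = 0" if "h \<in> polys_in (- {v})" "v \<in> {p, q}" for h v
    using lookup_eq_0_if_free[OF polys_in_mult[OF that(1)], of ?H m] H_in m that(2) by auto
  have linear: "Poly_Mapping.lookup (Var v * h * ?H) m = 0" if "h \<in> polys_in (- {v})" "v \<in> {p, q}" for h v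
    using lookup_eq_0_if_linear[OF polys_in_mult[OF that(1)], of ?H m] H_in m that(2)
    by (auto simp: mult.assoc)
  have odd: "Poly_Mapping.lookup (h * ?H) m = 0" if "subst (flip r) h = - h" for h
    by (rule lookup_eq_0_if_flip_invariant[of r])
      (use dist m that in \<open>simp_all add: subst_psubst2 f1_in[OF g] psubst_f1_minus_left[OF g]\<close>)
  \<comment> \<open>The terms are grouped by the reason for which they do not contribute.\<close>
  have "e_at f ?a ?b 0 ?c 0 = ?F1 ?a ?b - ?F1 ?b ?c + ?F1 ?a ?c
      + (?F1 (?b - ?a) (- ?c) + ?F1 ?c (?b - ?a))
      + ?c * (?F0 (?a - ?b) (- ?b) - ?F0 (- ?a) (?b - ?a))
      + ?a * ?F0 (- ?c) (- ?c) - ?b * ?F0 (- ?c) (- ?c) + ?b * ?F0 ?c ?a - ?a * ?F0 ?b ?c"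
    by (simp add: e_at_eq[OF f] psubst_f1_minus_left[OF f, of ?b] psubst_f1_minus_left[OF f, of ?c]
        psubst_f1_minus_right[OF f, of ?c ?b] psubst_f1_swap[OF f, where x = ?b and y = ?c]
        psubst_f1_swap[OF f, where x = ?a and y = ?b] algebra_simps)
  moreover have "Poly_Mapping.lookup (?F1 ?b ?c * ?H) m = 0"
    using dist by (auto intro!: free[of _ p] polys_in_psubst2 f1_in f)
  moreover have "Poly_Mapping.lookup (?F1 ?a ?c * ?H) m = 0"
    using dist by (auto intro!: free[of _ q] polys_in_psubst2 f1_in f)
  moreover have "Poly_Mapping.lookup ((?F1 (?b - ?a) (- ?c) + ?F1 ?c (?b - ?a)) * ?H) m = 0"
    "Poly_Mapping.lookup (?c * (?F0 (?a - ?b) (- ?b) - ?F0 (- ?a) (?b - ?a)) * ?H) m = 0"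
    by (rule odd; use dist f in \<open>simp add: subst_psubst2 f0_in f1_in psubst_f1_minus_left psubst_f1_minus_right\<close>)+
  moreover have "Poly_Mapping.lookup (?a * ?F0 (- ?c) (- ?c) * ?H) m = 0" "Poly_Mapping.lookup (?a * ?F0 ?b ?c * ?H) m = 0"
    "Poly_Mapping.lookup (?b * ?F0 (- ?c) (- ?c) * ?H) m = 0" "Poly_Mapping.lookup (?b * ?F0 ?c ?a * ?H) m = 0"
    using dist by (auto intro!: linear polys_in_psubst2 polys_in_uminus f0_in f)
  ultimately show ?thesis
    by (simp only: distrib_right[of _ _ ?H] left_diff_distrib[of _ _ ?H] lookup_add lookup_minus)
qed

text \<open>The pairs \<open>(4, 5)\<close> and \<open>(1, 2)\<close> are kept together to match the product of a polynomial in \<open>x\<^sub>4, x\<^sub>5\<close>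
  with one in \<open>x\<^sub>1, x\<^sub>2\<close>.\<close>

definition mono4 :: "nat \<Rightarrow> nat \<Rightarrow> nat \<Rightarrow> nat \<Rightarrow> nat \<Rightarrow>\<^sub>0 nat" where
  "mono4 i j k l = Poly_Mapping.single 4 k + Poly_Mapping.single 5 l +
     (Poly_Mapping.single 1 i + Poly_Mapping.single 2 j)"

lemma lookup_mono4:
  "Poly_Mapping.lookup (mono4 i j k l) v =
    (if v = 1 then i else if v = 2 then j else if v = 4 then k else if v = 5 then l else 0)"
  by (simp add: mono4_def lookup_add lookup_single)

definition f1_coeff :: "nat \<times> nat \<Rightarrow> mpol \<Rightarrow> rat" where
  "f1_coeff = (\<lambda>(i, j) f. Poly_Mapping.lookup (f1 f) (Poly_Mapping.single 0 i + Poly_Mapping.single 1 j))"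

lemma lookup_f1_product:
  assumes f: "f \<in> even_alternating" and g: "g \<in> even_alternating"
  shows "Poly_Mapping.lookup (psubst (f1 f) [Var 4, Var 5] * psubst (f1 g) [Var 1, Var 2]) (mono4 i j k l)
    = f1_coeff (k, l) f * f1_coeff (i, j) g"
proof -
  have "Poly_Mapping.lookup (psubst (f1 f) [Var 4, Var 5] * psubst (f1 g) [Var 1, Var 2]) (mono4 i j k l) =
    Poly_Mapping.lookup (psubst (f1 f) [Var 4, Var 5]) (Poly_Mapping.single 4 k + Poly_Mapping.single 5 l) *
    Poly_Mapping.lookup (psubst (f1 g) [Var 1, Var 2]) (Poly_Mapping.single 1 i + Poly_Mapping.single 2 j)"
    unfolding mono4_def
    by (rule lookup_mult_disjoint[of _ "{4, 5}" _ "{1, 2}"])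
      (use f g in \<open>simp_all add: polys_in_psubst2 f1_in keys_pair\<close>)
  then show ?thesis
    by (simp add: lookup_rename2 f1_in f g f1_coeff_def)
qed

text \<open>Both mixed terms of \<open>psubst_e_circ\<close> have the same coefficient as the third term, so that one copy of
  the product of \<open>f\<^sub>1\<close> and \<open>g\<^sub>1\<close> survives.\<close>

lemma lookup_e_circ:
  assumes f: "f \<in> even_alternating" and g: "g \<in> even_alternating"
    and ijkl: "odd i" "odd j" "odd k" "odd l" "i \<ge> 3" "j \<ge> 3" "k \<ge> 3" "l \<ge> 3"
  shows "Poly_Mapping.lookup (psubst (e_circ f g) (0 # map Var [1..<9])) (mono4 i j k l) =
    f1_coeff (k, l) f * f1_coeff (i, j) g"
proof -
  let ?\<rho> = "\<lambda>i. if i \<in> {1, 2, 4, 5} then Var i else 0"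
  let ?F = "psubst (f1 f) [Var 4, Var 5]" and ?G = "psubst (f1 g) [Var 1, Var 2]"
  have "length (0 # map Var [1..<9]) = 9" by simp
  then have in_length: "e_circ f g \<in> polys_in {..<length (0 # map Var [1..<9])}"
    by (simp only: e_circ_in[OF f g])
  have "Poly_Mapping.keys (mono4 i j k l) \<subseteq> {1, 2, 4, 5}"
    by (auto simp: in_keys_iff lookup_mono4 split: if_splits)
  then have "Poly_Mapping.lookup (psubst (e_circ f g) (0 # map Var [1..<9])) (mono4 i j k l) =
      Poly_Mapping.lookup (subst ?\<rho> (psubst (e_circ f g) (0 # map Var [1..<9]))) (mono4 i j k l)"
    by (rule lookup_restrict[symmetric])
  also have "subst ?\<rho> (psubst (e_circ f g) (0 # map Var [1..<9])) =
      psubst (e_circ f g) [0, Var 1, Var 2, 0, Var 4, Var 5, 0, 0, 0]"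
    by (subst subst_psubst[OF in_length]) (simp add: upt_rec)
  also have "Poly_Mapping.lookup \<dots> (mono4 i j k l) =
      Poly_Mapping.lookup (e_at f (Var 4) (Var 5) 0 (Var 2) 0 * ?G) (mono4 i j k l) +
      Poly_Mapping.lookup (e_at g (Var 1) (Var 2) 0 (Var 4) 0 * ?F) (mono4 i j k l) -
      Poly_Mapping.lookup (?F * ?G) (mono4 i j k l)"
    by (simp add: psubst_e_circ[OF f g] lookup_add lookup_minus mult.commute)
  also have "Poly_Mapping.lookup (e_at f (Var 4) (Var 5) 0 (Var 2) 0 * ?G) (mono4 i j k l) =
      Poly_Mapping.lookup (?F * ?G) (mono4 i j k l)"
    using lookup_e_at_mult_f1[OF f g, of 4 5 2 1 "mono4 i j k l"] ijkl
    by (simp add: lookup_mono4 psubst_f1_swap[OF g, where x = "Var 1" and y = "Var 2"])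
  also have "Poly_Mapping.lookup (e_at g (Var 1) (Var 2) 0 (Var 4) 0 * ?F) (mono4 i j k l) =
      Poly_Mapping.lookup (?F * ?G) (mono4 i j k l)"
    using lookup_e_at_mult_f1[OF g f, of 1 2 4 5 "mono4 i j k l"] ijkl
    by (simp add: lookup_mono4 mult.commute)
  finally show ?thesis
    by (simp add: lookup_f1_product[OF f g])
qed

lemma lookup_e_bracket:
  assumes f: "f \<in> period_space" and g: "g \<in> period_space"
    and ijkl: "odd i" "odd j" "odd k" "odd l" "i \<ge> 3" "j \<ge> 3" "k \<ge> 3" "l \<ge> 3"
  shows "Poly_Mapping.lookup (e_bracket f g) (mono4 i j k l) =
    f1_coeff (k, l) f * f1_coeff (i, j) g - f1_coeff (k, l) g * f1_coeff (i, j) f"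
proof -
  have "f \<in> even_alternating" "g \<in> even_alternating"
    using f g period_space_subset_even_alternating by auto
  then show ?thesis
    using ijkl by (simp add: e_bracket_eq[OF f g] lookup_minus lookup_e_circ)
qed

section \<open>Injectivity\<close>

lemma subspace_polys_in: "qvs.subspace (polys_in W)"
  by (simp add: qvs.subspace_def polys_in_add polys_in_scl)

lemma e_bracket_in:
  assumes "f \<in> period_space" "g \<in> period_space"
  shows "e_bracket f g \<in> polys_in {1..8}"
proof -
  have "length (0 # map Var [1..<9]) = 9" by simp
  moreover have "e_circ f g - e_circ g f \<in> polys_in {..<9}"
    using assms period_space_subset_even_alternating by (intro polys_in_diff e_circ_in) auto
  ultimately have "e_circ f g - e_circ g f \<in> polys_in {..<length (0 # map Var [1..<9])}"
    by (simp only:)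
  then show ?thesis
    unfolding e_bracket_eq[OF assms] by (rule polys_in_psubst) auto
qed

interpretation e_form: alternating_form period_space e_bracket
proof
  fix f f' g :: mpol and c
  assume f: "f \<in> period_space" and g: "g \<in> period_space"
  have f_e: "f \<in> even_alternating" using f period_space_subset_even_alternating by auto
  show "e_bracket (scl c f) g = scl c (e_bracket f g)"
    by (simp add: e_bracket_eq f f_e g qvs.subspace_scale[OF subspace_period_space] e_circ_def e_hom_scl
      circ_hom_scl_left circ_hom_scl_right qvs.scale_right_diff_distrib)
  show "e_bracket g f = - e_bracket f g"
    by (simp add: e_bracket_eq f g)
  assume f': "f' \<in> period_space"
  then have f'_e: "f' \<in> even_alternating" using period_space_subset_even_alternating by auto
  show "e_bracket (f + f') g = e_bracket f g + e_bracket f' g"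
    by (simp add: e_bracket_eq f f_e f' f'_e g qvs.subspace_add[OF subspace_period_space] e_circ_def e_hom_add
      circ_hom_add_left circ_hom_add_right)
qed (rule subspace_period_space)

lemma f1_coeff_add:
  "f \<in> even_alternating \<Longrightarrow> g \<in> even_alternating \<Longrightarrow> f1_coeff \<alpha> (f + g) = f1_coeff \<alpha> f + f1_coeff \<alpha> g"
  by (cases \<alpha>) (simp add: f1_coeff_def f1_def f0_add distrib_left lookup_add)

lemma f1_coeff_scl:
  "f \<in> even_alternating \<Longrightarrow> f1_coeff \<alpha> (scl c f) = c * f1_coeff \<alpha> f"
  by (cases \<alpha>) (simp add: f1_coeff_def f1_def f0_scl scl_mult_right)

text \<open>The coefficients of \<open>f\<^sub>1\<close> at odd exponents \<open>i, j \<ge> 3\<close> serve as the jointly injective functionals.\<close>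

lemma e_bracket_kernel:
  assumes "u \<in> free2 period_space" "extend_gen e_bracket u = 0"
  shows "u \<in> qvs.span (ext2_relators period_space)"
proof -
  let ?I = "{(i, j). odd i \<and> odd j \<and> i \<ge> (3 :: nat) \<and> j \<ge> (3 :: nat)}"
  show ?thesis
  proof (rule e_form.extend_gen_eq_0_imp_relation[where I = ?I and \<phi> = f1_coeff
        and \<mu> = "\<lambda>(k, l) (i, j). mono4 i j k l", OF _ _ _ _ assms])
    fix \<alpha> c and f g :: mpol assume "f \<in> period_space" "g \<in> period_space"
    then show "f1_coeff \<alpha> (f + g) = f1_coeff \<alpha> f + f1_coeff \<alpha> g"
      using period_space_subset_even_alternating by (intro f1_coeff_add) auto
  next
    fix \<alpha> c and f :: mpol assume "f \<in> period_space"
    then show "f1_coeff \<alpha> (scl c f) = c * f1_coeff \<alpha> f"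
      using period_space_subset_even_alternating by (intro f1_coeff_scl) auto
  next
    fix f assume "f \<in> period_space" "\<And>\<alpha>. \<alpha> \<in> ?I \<Longrightarrow> f1_coeff \<alpha> f = 0"
    then show "f = 0"
      by (intro period_space_eq_0I) (auto simp: f1_coeff_def)
  next
    fix \<alpha> \<beta> and f g :: mpol
    assume "\<alpha> \<in> ?I" "\<beta> \<in> ?I" "f \<in> period_space" "g \<in> period_space"
    then show "Poly_Mapping.lookup (e_bracket f g) ((\<lambda>(k, l) (i, j). mono4 i j k l) \<alpha> \<beta>) =
        f1_coeff \<alpha> f * f1_coeff \<beta> g - f1_coeff \<alpha> g * f1_coeff \<beta> f"
      by (auto simp: lookup_e_bracket)
  qed
qed

theorem corollary9p5:
  shows "\<exists>L. L \<in> ext2 period_space \<rightarrow> polys_in {1..8} \<and> ext2_linear period_space L \<and>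
           (\<forall>f\<in>period_space. \<forall>g\<in>period_space. L (wedge period_space f g) = e_bracket f g) \<and>
           inj_on L (ext2 period_space)"
  using e_form.induced_in[OF subspace_polys_in e_bracket_in] e_form.ext2_linear_induced
    e_form.induced_wedge e_form.inj_on_induced[OF e_bracket_kernel]
  by blast

end
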